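(* Let $\mathcal{A}\in Sp(2d,\mathbb{R})$ have a decomposition $$\mathcal{A}=D_L\,V_{\tilde A}\,V_{\tilde B}^T\,V_A,$$ with $L\in GL(2d,\mathbb{R})$ and $A,\tilde A,\tilde B\in\mathbb{R}^{2d\times2d}$ symmetric, such that $A$ and $\tilde B$ are simultaneously diagonalisable. Then for any compact $K\subset\mathbb{R}^{2d}$ there exists a lattice $\Lambda\subset\mathbb{R}^{2d}$ (i.e. $\Lambda=G\mathbb{Z}^{2d}$ for some $G\in GL(2d,\mathbb{R})$) such that $$\mathcal{P}_{\mathcal{A},K}:=\{T\in\mathcal{HS}:\ \mathrm{supp}(\sigma_T^{\mathcal{A}})\subset K\}$$ is identifiable on $\Lambda$ with respect to the Gaussian window $S_0=\varphi_0\otimes\varphi_0$, where $\varphi_0(t)=2^{d/4}e^{-\pi t\cdot t}$, $t\in\mathbb{R}^d$.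
   Context: $\mathcal{HS}$ denotes the Hilbert-Schmidt operators on $L^2(\mathbb{R}^d)$. For $f,g\in L^2(\mathbb{R}^d)$, $f\otimes g:=\langle\cdot,g\rangle f$. The Weyl symbol $\sigma_T$ of an operator $T$ is determined by linear (and duality) extension from $\sigma_{f\otimes g}(x,\omega)=\int_{\mathbb{R}^d}f(x+\tfrac t2)\overline{g(x-\tfrac t2)}e^{-2\pi it\cdot\omega}dt$; the map $T\mapsto\sigma_T$ is unitary from $\mathcal{HS}$ onto $L^2(\mathbb{R}^{2d})$. $\mathfrak{S}$ (resp. $\mathfrak{S}'$) is the set of operators with Weyl symbol in $\mathscr{S}(\mathbb{R}^{2d})$ (resp. $\mathscr{S}'(\mathbb{R}^{2d})$). For $z=(x,\omega)$, $\rho(z)f(t)=e^{-\pi i\omega\cdot x}e^{2\pi i\omega\cdot t}f(t-x)$ (same notation on any $\mathbb{R}^n$), and $\alpha_z(S)=\rho(z)S\rho(z)^*$, so $\sigma_{\alpha_z(S)}(\cdot)=\sigma_S(\cdot-z)$. The diagonal of the polarised Cohen's class of $T$ with window $S$ is $Q_ST(z,z)=\langle T,\alpha_z(S)\rangle=\langle\sigma_T,\sigma_S(\cdot-z)\rangle$. Identifiability: a set of operators $\mathcal{T}\subset\mathfrak{S}'$ is identifiable on the lattice $\Lambda$ with respect to the window $S\in\mathfrak{S}$ if the map $T\mapsto\{Q_ST(\lambda,\lambda)\}_{\lambda\in\Lambda}$ is injective from $\mathcal{T}$ to $\ell^\infty(\Lambda)$. $Sp(2d,\mathbb{R})$ is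 the group of real $4d\times4d$ matrices with $\mathcal{A}^TJ\mathcal{A}=J$, $J=\begin{pmatrix}0&I\\-I&0\end{pmatrix}$, $I=I_{2d}$. For symmetric $C\in\mathbb{R}^{2d\times2d}$ and $L\in GL(2d,\mathbb{R})$, $$V_C=\begin{pmatrix}I&0\\C&I\end{pmatrix},\qquad D_L=\begin{pmatrix}L^{-1}&0\\0&L^T\end{pmatrix}.$$ (Every element of $Sp(2d,\mathbb{R})$ admits a decomposition of the form $D_LV_{\tilde A}V_{\tilde B}^TV_A$.) Simultaneously diagonalisable means: there is a real orthogonal $U$ such that $U^TAU$ and $U^T\tilde BU$ are both diagonal. For $\mathcal{A}\in Sp(2d,\mathbb{R})$, $\mu(\mathcal{A})$ is the unitary operator on $L^2(\mathbb{R}^{2d})$, unique up to a unimodular constant (fix any choice), with $\mu(\mathcal{A})\rho(\xi)\mu(\mathcal{A})^*=\rho(\mathcal{A}\xi)$ for $\xi\in\mathbb{R}^{4d}$. The $\mathcal{A}$-Weyl symbol is $\sigma_T^{\mathcal{A}}:=\mu(\mathcal{A})\sigma_T$. *)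

theory Defs
  imports "HOL-Probability.Probability"
begin

section \<open>The Hilbert space of square-integrable functions modulo null sets\<close>

definition square_integrable :: "('a::euclidean_space \<Rightarrow> complex) \<Rightarrow> bool" where
  "square_integrable f \<longleftrightarrow> f \<in> borel_measurable lborel \<and> integrable lborel (\<lambda>x. (cmod (f x))\<^sup>2)"

lemma square_integrable_mult_integrable:
  assumes "square_integrable f" "square_integrable g"
  shows "integrable lborel (\<lambda>x. f x * cnj (g x))"
proof (rule Bochner_Integration.integrable_bound)
  show "integrable lborel (\<lambda>x. (cmod (f x))\<^sup>2 + (cmod (g x))\<^sup>2)"
    using assms by (auto simp: square_integrable_def)
  have "cnj \<in> borel_measurable borel"
    by (intro borel_measurable_continuous_onI continuous_intros)
  then show "(\<lambda>x. f x * cnj (g x)) \<in> borel_measurable lborel"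
    using assms unfolding square_integrable_def
    by (intro borel_measurable_times measurable_compose[of g lborel borel cnj borel]) auto
  have "cmod (f x) * cmod (g x) \<le> (cmod (f x))\<^sup>2 + (cmod (g x))\<^sup>2" for x
  proof -
    have "0 \<le> (cmod (f x) - cmod (g x))\<^sup>2" "0 \<le> cmod (f x) * cmod (g x)" by auto
    then show ?thesis unfolding power2_diff by linarith
  qed
  then show "AE x in lborel. norm (f x * cnj (g x)) \<le> norm ((cmod (f x))\<^sup>2 + (cmod (g x))\<^sup>2)"
    by (auto simp: norm_mult)
qed

lemma square_integrable_add:
  assumes "square_integrable f" "square_integrable g"
  shows "square_integrable (\<lambda>x. f x + g x)"
  unfolding square_integrable_def
proof
  show m: "(\<lambda>x. f x + g x) \<in> borel_measurable lborel"
    using assms unfolding square_integrable_def by auto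
  show "integrable lborel (\<lambda>x. (cmod (f x + g x))\<^sup>2)"
  proof (rule Bochner_Integration.integrable_bound)
    show "integrable lborel (\<lambda>x. 2 * (cmod (f x))\<^sup>2 + 2 * (cmod (g x))\<^sup>2)"
      using assms by (auto simp: square_integrable_def)
    show "(\<lambda>x. (cmod (f x + g x))\<^sup>2) \<in> borel_measurable lborel"
      using m by measurable
    have "(cmod (f x + g x))\<^sup>2 \<le> 2 * (cmod (f x))\<^sup>2 + 2 * (cmod (g x))\<^sup>2" for x
    proof -
      have "(cmod (f x + g x))\<^sup>2 \<le> (cmod (f x) + cmod (g x))\<^sup>2"
        by (intro power_mono norm_triangle_ineq) auto
      moreover have "0 \<le> (cmod (f x) - cmod (g x))\<^sup>2" by auto
      ultimately show ?thesis by (simp add: power2_diff power2_sum)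
    qed
    then show "AE x in lborel. norm ((cmod (f x + g x))\<^sup>2) \<le> norm (2 * (cmod (f x))\<^sup>2 + 2 * (cmod (g x))\<^sup>2)"
      by auto
  qed
qed

lemma square_integrable_scale:
  "square_integrable f \<Longrightarrow> square_integrable (\<lambda>x. c * f x)"
  by (auto simp: square_integrable_def norm_mult power_mult_distrib)

lemma square_integrable_uminus:
  "square_integrable f \<Longrightarrow> square_integrable (\<lambda>x. - f x)"
  by (auto simp: square_integrable_def)

lemma square_integrable_diff:
  "square_integrable f \<Longrightarrow> square_integrable g \<Longrightarrow> square_integrable (\<lambda>x. f x - g x)"
  using square_integrable_add[OF _ square_integrable_uminus[of g]] by simp

lemma square_integrable_zero: "square_integrable (\<lambda>x. 0)"
  by (auto simp: square_integrable_def)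

definition L2rel :: "('a::euclidean_space \<Rightarrow> complex) \<Rightarrow> ('a \<Rightarrow> complex) \<Rightarrow> bool" where
  "L2rel f g \<longleftrightarrow> square_integrable f \<and> square_integrable g \<and> (AE x in lborel. f x = g x)"

lemma part_equivp_L2rel: "part_equivp L2rel"
proof (rule part_equivpI)
  show "\<exists>f::'a \<Rightarrow> complex. L2rel f f"
    using square_integrable_zero by (auto simp: L2rel_def)
  show "symp (L2rel :: ('a \<Rightarrow> complex) \<Rightarrow> _)" by (auto simp: symp_def L2rel_def)
  show "transp (L2rel :: ('a \<Rightarrow> complex) \<Rightarrow> _)" by (fastforce simp: transp_def L2rel_def)
qed

quotient_type (overloaded) 'a L2 = "'a::euclidean_space \<Rightarrow> complex" / partial: L2rel
  by (rule part_equivp_L2rel)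

lift_definition scaleC :: "complex \<Rightarrow> 'a::euclidean_space L2 \<Rightarrow> 'a L2" (infixr "*\<^sub>C" 75)
  is "\<lambda>c f x. c * f x"
  by (auto simp: L2rel_def intro: square_integrable_scale)

lift_definition cinner :: "'a::euclidean_space L2 \<Rightarrow> 'a L2 \<Rightarrow> complex"
  is "\<lambda>f g. LINT x|lborel. f x * cnj (g x)"
  subgoal premises prems for f1 f2 g1 g2
  proof (rule integral_cong_AE)
    have m: "(\<lambda>x. f x * cnj (g x)) \<in> borel_measurable lborel"
      if "square_integrable f" "square_integrable g" for f g :: "'a \<Rightarrow> complex"
      using square_integrable_mult_integrable[OF that] by auto
    show "(\<lambda>x. f1 x * cnj (g1 x)) \<in> borel_measurable lborel"
         "(\<lambda>x. f2 x * cnj (g2 x)) \<in> borel_measurable lborel"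
      using prems by (intro m; simp add: L2rel_def)+
    show "AE x in lborel. f1 x * cnj (g1 x) = f2 x * cnj (g2 x)"
      using prems by (auto simp: L2rel_def)
  qed
  done

instantiation L2 :: (euclidean_space) real_inner
begin

lift_definition zero_L2 :: "'a L2" is "\<lambda>x. 0"
  by (auto simp: L2rel_def square_integrable_zero)

lift_definition plus_L2 :: "'a L2 \<Rightarrow> 'a L2 \<Rightarrow> 'a L2" is "\<lambda>f g x. f x + g x"
  by (auto simp: L2rel_def intro: square_integrable_add)

lift_definition minus_L2 :: "'a L2 \<Rightarrow> 'a L2 \<Rightarrow> 'a L2" is "\<lambda>f g x. f x - g x"
  by (auto simp: L2rel_def intro: square_integrable_diff)

lift_definition uminus_L2 :: "'a L2 \<Rightarrow> 'a L2" is "\<lambda>f x. - f x"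
  by (auto simp: L2rel_def intro: square_integrable_uminus)

definition scaleR_L2 :: "real \<Rightarrow> 'a L2 \<Rightarrow> 'a L2" where
  "scaleR_L2 r f = complex_of_real r *\<^sub>C f"

definition inner_L2 :: "'a L2 \<Rightarrow> 'a L2 \<Rightarrow> real" where
  "inner_L2 f g = Re (cinner f g)"

definition norm_L2 :: "'a L2 \<Rightarrow> real" where
  "norm_L2 f = sqrt (inner f f)"

definition sgn_L2 :: "'a L2 \<Rightarrow> 'a L2" where
  "sgn_L2 f = scaleR (inverse (norm f)) f"

definition dist_L2 :: "'a L2 \<Rightarrow> 'a L2 \<Rightarrow> real" where
  "dist_L2 f g = norm (f - g)"

definition uniformity_L2 :: "('a L2 \<times> 'a L2) filter" where
  "uniformity_L2 = (INF e\<in>{0<..}. principal {(x, y). dist x y < e})"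

definition open_L2 :: "'a L2 set \<Rightarrow> bool" where
  "open_L2 U \<longleftrightarrow> (\<forall>x\<in>U. eventually (\<lambda>(x', y). x' = x \<longrightarrow> y \<in> U) uniformity)"

lemma cinner_add_left: "cinner (f + g) h = cinner f h + cinner g (h :: 'a L2)"
proof (transfer, goal_cases)
  case (1 f g h)
  then have "integrable lborel (\<lambda>x. f x * cnj (h x))" "integrable lborel (\<lambda>x. g x * cnj (h x))"
    by (auto simp: L2rel_def intro!: square_integrable_mult_integrable)
  then show ?case by (simp add: ring_distribs)
qed

lemma cinner_commute: "cinner f g = cnj (cinner g (f :: 'a L2))"
  by transfer (simp add: Bochner_Integration.integral_cnj[symmetric] mult.commute)

lemma cinner_scaleC_left: "cinner (c *\<^sub>C f) g = c * cinner f (g :: 'a L2)"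
  by transfer (simp add: mult.assoc)

lemma cinner_self:
  shows "Re (cinner f f) \<ge> 0" and "Re (cinner f f) = 0 \<longleftrightarrow> f = (0 :: 'a L2)"
proof -
  have "(LINT x|lborel. f x * cnj (f x)) = complex_of_real (LINT x|lborel. (cmod (f x))\<^sup>2)"
    for f :: "'a \<Rightarrow> complex"
    by (subst integral_complex_of_real[symmetric]) (simp only: complex_norm_square)
  note eq = this
  show "Re (cinner f f) \<ge> 0"
    by transfer (simp add: eq)
  show "Re (cinner f f) = 0 \<longleftrightarrow> f = (0 :: 'a L2)"
  proof (transfer, goal_cases)
    case (1 f)
    then have "integrable lborel (\<lambda>x. (cmod (f x))\<^sup>2)" "square_integrable f"
      by (auto simp: L2rel_def square_integrable_def)
    then show ?case
      by (simp add: eq integral_nonneg_eq_0_iff_AE L2rel_def square_integrable_zero)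
  qed
qed

instance
proof
  fix a b c :: "'a L2" and r s :: real
  show "a + b + c = a + (b + c)"
    by transfer (auto simp: L2rel_def algebra_simps intro!: square_integrable_add)
  show "a + b = b + a"
    by transfer (auto simp: L2rel_def algebra_simps intro!: square_integrable_add)
  show "0 + a = a"
    by transfer (auto simp: L2rel_def)
  show "- a + a = 0"
    by transfer (auto simp: L2rel_def square_integrable_zero)
  show "a - b = a + - b"
    by transfer (auto simp: L2rel_def intro!: square_integrable_diff)
  show "r *\<^sub>R (a + b) = r *\<^sub>R a + r *\<^sub>R b"
    unfolding scaleR_L2_def
    by transfer (auto simp: L2rel_def ring_distribs intro!: square_integrable_add square_integrable_scale)
  show "(r + s) *\<^sub>R a = r *\<^sub>R a + s *\<^sub>R a"
    unfolding scaleR_L2_def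
    by transfer (auto simp: L2rel_def ring_distribs intro!: square_integrable_add square_integrable_scale)
  show "r *\<^sub>R s *\<^sub>R a = (r * s) *\<^sub>R a"
    unfolding scaleR_L2_def
    by transfer (auto simp: L2rel_def mult.assoc intro!: square_integrable_scale)
  show "1 *\<^sub>R a = a"
    unfolding scaleR_L2_def by transfer (auto simp: L2rel_def)
  show "dist a b = norm (a - b)" by (rule dist_L2_def)
  show "sgn a = scaleR (inverse (norm a)) a" by (rule sgn_L2_def)
  show "uniformity = (INF e\<in>{0<..}. principal {(x, y :: 'a L2). dist x y < e})"
    by (rule uniformity_L2_def)
  show "open U \<longleftrightarrow> (\<forall>x\<in>U. eventually (\<lambda>(x', y). x' = x \<longrightarrow> y \<in> U) uniformity)" for U :: "'a L2 set"
    by (rule open_L2_def)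
  show "inner a b = inner b a"
    unfolding inner_L2_def by (subst cinner_commute) simp
  show "inner (a + b) c = inner a c + inner b c"
    by (simp add: inner_L2_def cinner_add_left)
  show "inner (r *\<^sub>R a) b = r * inner a b"
    by (simp add: inner_L2_def scaleR_L2_def cinner_scaleC_left)
  show "0 \<le> inner a a" by (simp add: inner_L2_def cinner_self)
  show "(inner a a = 0) = (a = 0)" by (simp add: inner_L2_def cinner_self)
  show "norm a = sqrt (inner a a)" by (rule norm_L2_def)
qed

end


section \<open>Operators\<close>

definition cbounded_linear :: "('a::euclidean_space L2 \<Rightarrow> 'b::euclidean_space L2) \<Rightarrow> bool" where
  "cbounded_linear T \<longleftrightarrow> bounded_linear T \<and> (\<forall>c f. T (c *\<^sub>C f) = c *\<^sub>C T f)"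

definition cadjoint :: "('a::euclidean_space L2 \<Rightarrow> 'b::euclidean_space L2) \<Rightarrow> 'b L2 \<Rightarrow> 'a L2" where
  "cadjoint T = (THE T'. \<forall>f g. cinner (T f) g = cinner f (T' g))"

definition unitary_op :: "('a::euclidean_space L2 \<Rightarrow> 'b::euclidean_space L2) \<Rightarrow> bool" where
  "unitary_op U \<longleftrightarrow> cbounded_linear U \<and> surj U \<and> (\<forall>f g. cinner (U f) (U g) = cinner f g)"

definition orthonormal_basis :: "'a::euclidean_space L2 set \<Rightarrow> bool" where
  "orthonormal_basis B \<longleftrightarrow>
     (\<forall>e\<in>B. \<forall>e'\<in>B. cinner e e' = (if e = e' then 1 else 0)) \<and>
     (\<forall>f. ((\<lambda>e. cinner f e *\<^sub>C e) has_sum f) B)"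

definition hilbert_schmidt :: "('a::euclidean_space L2 \<Rightarrow> 'a L2) set" where
  "hilbert_schmidt =
     {T. cbounded_linear T \<and> (\<exists>B. orthonormal_basis B \<and> (\<lambda>e. (norm (T e))\<^sup>2) summable_on B)}"

text \<open>Neither \<^term>\<open>hilbert_schmidt\<close> nor the inner product below depends on the
  orthonormal basis that is used.\<close>

definition hs_inner :: "('a::euclidean_space L2 \<Rightarrow> 'a L2) \<Rightarrow> ('a L2 \<Rightarrow> 'a L2) \<Rightarrow> complex" where
  "hs_inner T S = (\<Sum>\<^sub>\<infinity>e\<in>(SOME B. orthonormal_basis B). cinner (T e) (S e))"

definition rank_one :: "'a::euclidean_space L2 \<Rightarrow> 'a L2 \<Rightarrow> 'a L2 \<Rightarrow> 'a L2" (infix "\<otimes>\<^sub>H" 70) where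
  "f \<otimes>\<^sub>H g = (\<lambda>h. cinner h g *\<^sub>C f)"


section \<open>Phase space\<close>

text \<open>A point $(x, \omega)$ of $\mathbb{R}^{2n}$ is a vector indexed by a sum type, with $x$ in the
  left and $\omega$ in the right summand. In this way $\mathbb{R}^{2d}$ is both the phase space
  of $\mathbb{R}^d$ and the configuration space of $\mathbb{R}^{4d}$.\<close>

definition pos :: "real ^ ('n::finite + 'n) \<Rightarrow> real ^ 'n" where
  "pos z = (\<chi> i. z $ Inl i)"

definition freq :: "real ^ ('n::finite + 'n) \<Rightarrow> real ^ 'n" where
  "freq z = (\<chi> i. z $ Inr i)"

lemma square_integrable_translate:
  fixes f :: "'a::euclidean_space \<Rightarrow> complex"
  assumes "square_integrable f"
  shows "square_integrable (\<lambda>t. f (t - x))"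
proof -
  have m: "f \<in> borel_measurable borel" and i: "integrable lborel (\<lambda>t. (cmod (f t))\<^sup>2)"
    using assms by (auto simp: square_integrable_def)
  have "integrable (distr lborel borel ((+) (- x))) (\<lambda>t. (cmod (f t))\<^sup>2)"
    using i by (simp add: lborel_distr_plus)
  then have "integrable lborel (\<lambda>t. (cmod (f (- x + t)))\<^sup>2)"
    using m by (subst (asm) integrable_distr_eq) auto
  then show ?thesis
    using m by (auto simp: square_integrable_def)
qed

lemma AE_lborel_translate:
  fixes x :: "'a::euclidean_space"
  assumes "AE t in lborel. P t" 
  shows "AE t in lborel. P (t - x)"
proof -
  obtain N where N: "{t. \<not> P t} \<subseteq> N" "N \<in> null_sets lborel"
    using assms by (auto simp: eventually_ae_filter)
  then have "AE t in distr lborel borel ((+) (- x)). t \<notin> N"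
    by (simp add: lborel_distr_plus AE_not_in)
  moreover have "{t. t \<notin> N} \<in> sets borel"
    using N by (auto simp: Compl_eq[symmetric])
  ultimately have "AE t in lborel. - x + t \<notin> N"
    by (subst (asm) AE_distr_iff) auto
  then show ?thesis
    using N(1) by (auto elim!: eventually_mono)
qed

lift_definition time_freq_shift :: "real ^ ('n::finite + 'n) \<Rightarrow> (real ^ 'n) L2 \<Rightarrow> (real ^ 'n) L2" ("\<rho>")
  is "\<lambda>z f t. cis (- pi * (freq z \<bullet> pos z)) * cis (2 * pi * (freq z \<bullet> t)) * f (t - pos z)"
  subgoal premises prems for z f g
  proof -
    let ?c = "\<lambda>t. cis (- pi * (freq z \<bullet> pos z)) * cis (2 * pi * (freq z \<bullet> t))"
    have c: "?c \<in> borel_measurable lborel"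
      by (auto intro!: borel_measurable_continuous_onI continuous_intros)
    have "square_integrable (\<lambda>t. ?c t * f (t - pos z))" if "square_integrable f" for f
      using square_integrable_translate[OF that, of "pos z"] c
      by (auto simp: square_integrable_def norm_mult intro!: borel_measurable_times)
    moreover have "AE t in lborel. f (t - pos z) = g (t - pos z)"
      using prems by (intro AE_lborel_translate) (auto simp: L2rel_def)
    ultimately show ?thesis
      using prems by (auto simp: L2rel_def)
  qed
  done

definition op_shift :: "real ^ ('n::finite + 'n) \<Rightarrow> ((real ^ 'n) L2 \<Rightarrow> (real ^ 'n) L2) \<Rightarrow>
    ((real ^ 'n) L2 \<Rightarrow> (real ^ 'n) L2)" where
  "op_shift z S = \<rho> z \<circ> S \<circ> cadjoint (\<rho> z)"

definition cohen_diag :: "((real ^ 'n::finite) L2 \<Rightarrow> (real ^ 'n) L2) \<Rightarrow> ((real ^ 'n) L2 \<Rightarrow> (real ^ 'n) L2) \<Rightarrow>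
    real ^ ('n + 'n) \<Rightarrow> complex" where
  "cohen_diag S T z = hs_inner T (op_shift z S)"


section \<open>The Weyl symbol\<close>

text \<open>The Weyl symbol of $f \otimes g$. The integral does not depend on the chosen
  representatives and, by Moyal's identity, is a square-integrable function of $(x, \omega)$, so
  that passing to its class with \<^const>\<open>abs_L2\<close> is legitimate.\<close>

definition wigner :: "(real ^ 'n::finite) L2 \<Rightarrow> (real ^ 'n) L2 \<Rightarrow> (real ^ ('n + 'n)) L2" where
  "wigner f g = abs_L2 (\<lambda>z. LINT t|lborel.
     rep_L2 f (pos z + t /\<^sub>R 2) * cnj (rep_L2 g (pos z - t /\<^sub>R 2)) * cis (- 2 * pi * (t \<bullet> freq z)))"

text \<open>Extension from the rank-one operators by duality: the map from $T$ to its symbol is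
  unitary, so the symbol of a Hilbert-Schmidt operator $T$ is the unique $\sigma$ with
  $\langle T, f \otimes g\rangle = \langle\sigma, \sigma_{f \otimes g}\rangle$ for all $f, g$.\<close>

definition has_weyl_symbol ::
    "((real ^ 'n::finite) L2 \<Rightarrow> (real ^ 'n) L2) \<Rightarrow> (real ^ ('n + 'n)) L2 \<Rightarrow> bool" where
  "has_weyl_symbol T \<sigma> \<longleftrightarrow> (\<forall>f g. hs_inner T (f \<otimes>\<^sub>H g) = cinner \<sigma> (wigner f g))"

definition L2_support :: "'a::euclidean_space L2 \<Rightarrow> 'a set" where
  "L2_support \<sigma> = - \<Union>{V. open V \<and> (AE x in lborel. x \<in> V \<longrightarrow> rep_L2 \<sigma> x = 0)}"


section \<open>Symplectic matrices and metaplectic operators\<close>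

definition block_mat :: "'a ^ 'n ^ 'n \<Rightarrow> 'a ^ 'n ^ 'n \<Rightarrow> 'a ^ 'n ^ 'n \<Rightarrow> 'a ^ 'n ^ 'n \<Rightarrow>
    'a ^ ('n::finite + 'n) ^ ('n + 'n)" where
  "block_mat P Q R S = (\<chi> i j. case i of
      Inl a \<Rightarrow> (case j of Inl b \<Rightarrow> P $ a $ b | Inr b \<Rightarrow> Q $ a $ b)
    | Inr a \<Rightarrow> (case j of Inl b \<Rightarrow> R $ a $ b | Inr b \<Rightarrow> S $ a $ b))"

definition J_mat :: "real ^ ('n::finite + 'n) ^ ('n + 'n)" where
  "J_mat = block_mat 0 (mat 1) (- mat 1) 0"

definition symplectic :: "real ^ ('n::finite + 'n) ^ ('n + 'n) \<Rightarrow> bool" where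
  "symplectic M \<longleftrightarrow> transpose M ** J_mat ** M = J_mat"

definition V_mat :: "real ^ 'n ^ 'n \<Rightarrow> real ^ ('n::finite + 'n) ^ ('n + 'n)" where
  "V_mat C = block_mat (mat 1) 0 C (mat 1)"

definition D_mat :: "real ^ 'n ^ 'n \<Rightarrow> real ^ ('n::finite + 'n) ^ ('n + 'n)" where
  "D_mat L = block_mat (matrix_inv L) 0 0 (transpose L)"

definition diagonal_mat :: "real ^ 'n ^ 'n::finite \<Rightarrow> bool" where
  "diagonal_mat M \<longleftrightarrow> (\<forall>i j. i \<noteq> j \<longrightarrow> M $ i $ j = 0)"

definition simultaneously_diagonalisable :: "real ^ 'n ^ 'n::finite \<Rightarrow> real ^ 'n ^ 'n \<Rightarrow> bool" where
  "simultaneously_diagonalisable A B \<longleftrightarrow> (\<exists>U. orthogonal_matrix U \<and>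
     diagonal_mat (transpose U ** A ** U) \<and> diagonal_mat (transpose U ** B ** U))"

text \<open>\<^term>\<open>is_metaplectic M U\<close> says that $U$ is one of the possible choices of $\mu(M)$;
  they differ by unimodular constants.\<close>

definition is_metaplectic :: "real ^ ('n::finite + 'n) ^ ('n + 'n) \<Rightarrow>
    ((real ^ 'n) L2 \<Rightarrow> (real ^ 'n) L2) \<Rightarrow> bool" where
  "is_metaplectic M U \<longleftrightarrow> unitary_op U \<and> (\<forall>\<xi>. U \<circ> \<rho> \<xi> \<circ> cadjoint U = \<rho> (M *v \<xi>))"

text \<open>The operators $T$ for which \<open>\<sigma>\<close>$_T^{\mathcal A} = \mu(\mathcal A)\sigma_T$ has support
  in $K$, where $U$ is the chosen $\mu(\mathcal A)$.\<close>

definition symbol_supported :: "((real ^ ('n::finite + 'n)) L2 \<Rightarrow> (real ^ ('n + 'n)) L2) \<Rightarrow>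
    (real ^ ('n + 'n)) set \<Rightarrow> ((real ^ 'n) L2 \<Rightarrow> (real ^ 'n) L2) set" where
  "symbol_supported U K =
     {T \<in> hilbert_schmidt. \<exists>\<sigma>. has_weyl_symbol T \<sigma> \<and> L2_support (U \<sigma>) \<subseteq> K}"


section \<open>Identifiability\<close>

definition is_lattice :: "(real ^ 'n::finite) set \<Rightarrow> bool" where
  "is_lattice \<Lambda> \<longleftrightarrow> (\<exists>G :: real ^ 'n ^ 'n. invertible G \<and> \<Lambda> = (*v) G ` {k. \<forall>i. k $ i \<in> \<int>})"

definition ell_infty :: "'a set \<Rightarrow> ('a \<Rightarrow> complex) set" where
  "ell_infty \<Lambda> = {a \<in> extensional \<Lambda>. bounded (a ` \<Lambda>)}"

text \<open>Identifiability for sets of Hilbert-Schmidt operators, where the pairing in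
  \<^const>\<open>cohen_diag\<close> is the Hilbert-Schmidt inner product.\<close>

definition identifiable :: "(real ^ ('n + 'n)) set \<Rightarrow> ((real ^ 'n::finite) L2 \<Rightarrow> (real ^ 'n) L2) \<Rightarrow>
    ((real ^ 'n) L2 \<Rightarrow> (real ^ 'n) L2) set \<Rightarrow> bool" where
  "identifiable \<Lambda> S \<T> \<longleftrightarrow>
     (\<lambda>T. restrict (cohen_diag S T) \<Lambda>) \<in> \<T> \<rightarrow> ell_infty \<Lambda> \<and>
     inj_on (\<lambda>T. restrict (cohen_diag S T) \<Lambda>) \<T>"

lemma square_integrable_gaussian:
  "square_integrable (\<lambda>t::'a::euclidean_space. complex_of_real (c * exp (- pi * (t \<bullet> t))))"
proof -
  have *: "(cmod (complex_of_real (c * exp (- pi * (t \<bullet> t)))))\<^sup>2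
      = c\<^sup>2 * (\<Prod>b\<in>Basis. exp (- 2 * pi * (t \<bullet> b)\<^sup>2))" for t :: 'a
  proof -
    have "t \<bullet> t = (\<Sum>b\<in>Basis. (t \<bullet> b)\<^sup>2)"
      by (subst euclidean_inner) (simp add: power2_eq_square)
    then have "(\<Prod>b\<in>Basis. exp (- 2 * pi * (t \<bullet> b)\<^sup>2)) = exp (- 2 * pi * (t \<bullet> t))"
      by (simp add: exp_sum[symmetric] sum_distrib_left)
    also have "\<dots> = (exp (- pi * (t \<bullet> t)))\<^sup>2"
      by (simp add: exp_double[symmetric])
    finally show ?thesis
      by (simp only: norm_of_real power2_abs power_mult_distrib)
  qed
  have int1: "integrable lborel (\<lambda>x::real. exp (- 2 * pi * x\<^sup>2))"
  proof -
    have "integrable lborel (\<lambda>x::real. normal_density 0 (1 / (2 * sqrt pi)) x)"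
      by (rule integrable_normal_density) simp
    then have "integrable lborel (\<lambda>x::real. normal_density 0 (1 / (2 * sqrt pi)) x / sqrt 2)"
      by simp
    moreover have "normal_density 0 (1 / (2 * sqrt pi)) x / sqrt 2 = exp (- 2 * pi * x\<^sup>2)" for x
      by (simp add: normal_density_def power_divide power_mult_distrib real_sqrt_divide)
    ultimately show ?thesis by simp
  qed
  have "(\<integral>\<^sup>+t. (\<Prod>b\<in>Basis. ennreal (exp (- 2 * pi * ((t::'a) \<bullet> b)\<^sup>2))) \<partial>lborel)
      = (\<Prod>b\<in>(Basis::'a set). \<integral>\<^sup>+x. ennreal (exp (- 2 * pi * x\<^sup>2)) \<partial>lborel)"
    by (rule nn_integral_lborel_prod) auto
  also have "\<dots> < \<infinity>"
  proof -
    have "(\<integral>\<^sup>+x. ennreal (exp (- 2 * pi * x\<^sup>2)) \<partial>lborel) < \<infinity>"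
      using int1 by (simp add: integrable_iff_bounded)
    then show ?thesis
      unfolding prod_constant by (metis power_less_top_ennreal infinity_ennreal_def)
  qed
  finally have "integrable lborel (\<lambda>t::'a. \<Prod>b\<in>Basis. exp (- 2 * pi * (t \<bullet> b)\<^sup>2))"
    by (intro integrableI_bounded) (auto simp: prod_ennreal abs_prod)
  then show ?thesis
    unfolding square_integrable_def * by (auto intro!: borel_measurable_continuous_onI continuous_intros)
qed

lift_definition gaussian :: "(real ^ 'n::finite) L2"
  is "\<lambda>t. complex_of_real (2 powr (real CARD('n) / 4) * exp (- pi * (t \<bullet> t)))"
  by (simp only: L2rel_def square_integrable_gaussian) simp

definition gaussian_window :: "(real ^ 'n::finite) L2 \<Rightarrow> (real ^ 'n) L2" where
  "gaussian_window = gaussian \<otimes>\<^sub>H gaussian"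

end

theory Submission
  imports Defs "HOL-Complex_Analysis.Conformal_Mappings"
begin

text \<open>Let $f = \sigma_T$, $F = \mu(\mathcal A) f$ and $s_0(t) = e^{-2\pi t \cdot t}$, which is the Weyl
  symbol of the Gaussian window up to a constant. A sample of Cohen's class at $x$ is a multiple of
  $\langle f, \rho(x, 0) s_0\rangle$, and $\langle f, \rho(x, \omega) s_0\rangle$ is an explicit
  Gaussian factor times $B(4\pi x - 2\pi i \omega)$, where the entire function $B$ is the
  Laplace transform of $f s_0$. Write $\mathcal A^{-1}(0, \omega) = (P\omega, Q\omega)$. The
  intertwining property gives $\langle f, \rho(P\omega, Q\omega) s_0\rangle =
  \langle F, \rho(0, \omega)\, \mu(\mathcal A) s_0\rangle = E(-2\pi i \omega)$, where $E$ is the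
  Laplace transform of the product of $F$ and the conjugate of $\mu(\mathcal A) s_0$. Since $F$
  has bounded support, $E$ is entire of exponential type. By the identity theorem
  $E(-2\pi i\zeta) = e^{q(\zeta)} B(N\zeta)$ for all complex $\zeta$, with $q$ quadratic and
  $N = 4\pi P - 2\pi i Q$. The matrix $N$ is invertible because $\mathcal A^{-1}(0 \times
  \mathbb{R}^{2d})$ is Lagrangian. Hence, if all samples on a sufficiently fine lattice vanish,
  then so does an entire function of small exponential type at all integer points. By Carlson's
  theorem in each variable this function is zero, so $B = 0$ and then $f = 0$ by uniqueness of
  Fourier transforms. No explicit form of $\mu(\mathcal A)$ or of $\mu(\mathcal A) s_0$ is needed.\<close>

section \<open>Entire functions of small exponential type\<close>

text \<open>The factors are removed one at a time; each division leaves only a removable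
  singularity, so the quotient stays entire.\<close>

lemma entire_divide_zeros:
  fixes f :: "complex \<Rightarrow> complex"
  assumes "finite Z" "f holomorphic_on UNIV" "\<And>a. a \<in> Z \<Longrightarrow> f a = 0"
  obtains q where "q holomorphic_on UNIV" "\<And>s. f s = (\<Prod>a\<in>Z. s - a) * q s"
  using assms(1,3)
proof (induction Z arbitrary: thesis rule: finite_induct)
  case empty
  from empty.prems(1)[OF assms(2)] show ?case by simp
next
  case (insert a Z)
  obtain q where q: "q holomorphic_on UNIV" "\<And>s. f s = (\<Prod>a\<in>Z. s - a) * q s"
    using insert.IH insert.prems(2) by blast
  \<comment> \<open>The factors already removed do not vanish at the new point \<open>a\<close>, so
    the zero of \<open>f\<close> there must come from \<open>q\<close>.\<close>
  have "(\<Prod>b\<in>Z. a - b) \<noteq> 0"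
    using insert.hyps by auto
  then have qa: "q a = 0"
    using q(2)[of a] insert.prems(2)[of a] by simp
  let ?q = "\<lambda>z. if z = a then deriv q a else (q z - q a) / (z - a)"
  have "f s = (\<Prod>b\<in>insert a Z. s - b) * ?q s" for s
    using insert.hyps q(2)[of s] qa by auto
  with pole_lemma_open[OF q(1) open_UNIV, of a] show ?case
    by (rule insert.prems(1))
qed

text \<open>A weak form of Carlson's theorem, in which dividing out the zeros in \<open>{-N..N}\<close> and the
  maximum principle on the circle of radius \<open>4 N\<close> suffice.\<close>

lemma carlson_small_type:
  fixes f :: "complex \<Rightarrow> complex"
  assumes holf: "f holomorphic_on UNIV"
    and bnd: "\<And>s. cmod (f s) \<le> C * exp (cmod s / 10)"
    and zero: "\<And>k::int. f (of_int k) = 0"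
  shows "f s = 0"
proof -
  have C: "C \<ge> 0"
    using order_trans[OF norm_ge_zero bnd[of 0]] by simp
  \<comment> \<open>On the circle of radius \<open>4 N\<close> the growth bound gives
    \<open>exp (2 N / 5)\<close> and each of the \<open>2 N + 1\<close> factors is at least
    \<open>3 N\<close>; at \<open>s\<close> each factor is at most \<open>2 N\<close>. The quotient
    \<open>(2/3) ^ (2 N + 1)\<close> supplies the power of \<open>4/9\<close>.\<close>
  have est: "cmod (f s) \<le> C * (exp (2/5) * 4 / 9) ^ N" if N: "real N \<ge> cmod s" "N \<ge> 1" for N
  proof -
    define Z :: "complex set" where "Z = of_int ` {-int N..int N}"
    have cZ: "card Z = 2 * N + 1"
      unfolding Z_def by (subst card_image) (auto simp: inj_on_def)
    have Zle: "cmod a \<le> real N" if "a \<in> Z" for a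
      using that by (auto simp: Z_def abs_le_iff)
    obtain q where q: "q holomorphic_on UNIV" "\<And>s. f s = (\<Prod>a\<in>Z. s - a) * q s"
      by (rule entire_divide_zeros[of Z f]) (use holf zero in \<open>auto simp: Z_def\<close>)
    let ?B = "C * exp (2 / 5 * real N) / (3 * real N) ^ (2 * N + 1)"
    have "cmod (q s) \<le> ?B"
    proof (rule maximum_modulus_frontier[of q "cball 0 (4 * real N)"])
      show "q holomorphic_on interior (cball 0 (4 * real N))"
        using q(1) holomorphic_on_subset by blast
      show "continuous_on (closure (cball 0 (4 * real N))) q"
        using holomorphic_on_imp_continuous_on[OF q(1)] continuous_on_subset by blast
      show "bounded (cball (0::complex) (4 * real N))" by simp
      show "s \<in> cball 0 (4 * real N)" using N by simp
      show "cmod (q z) \<le> ?B" if z: "z \<in> frontier (cball 0 (4 * real N))" for z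
      proof -
        have z: "cmod z = 4 * real N" using z N by (simp add: frontier_cball)
        have "(\<Prod>a\<in>Z. 3 * real N) \<le> (\<Prod>a\<in>Z. cmod (z - a))"
        proof (intro prod_mono conjI)
          fix a assume "a \<in> Z"
          then show "3 * real N \<le> cmod (z - a)"
            using norm_triangle_ineq2[of z a] Zle[of a] z by linarith
        qed simp
        then have P: "(3 * real N) ^ (2 * N + 1) \<le> cmod (\<Prod>a\<in>Z. z - a)"
          unfolding prod_norm prod_constant cZ .
        have "(3 * real N) ^ (2 * N + 1) * cmod (q z) \<le> cmod (\<Prod>a\<in>Z. z - a) * cmod (q z)"
          by (intro mult_right_mono P) simp
        also have "\<dots> = cmod (f z)" by (simp add: q(2) norm_mult)
        also have "\<dots> \<le> C * exp (2 / 5 * real N)" using bnd[of z] z by simp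
        finally show ?thesis
          using N by (simp add: field_simps)
      qed
    qed
    moreover have "cmod (\<Prod>a\<in>Z. s - a) \<le> (2 * real N) ^ (2 * N + 1)"
    proof -
      have "(\<Prod>a\<in>Z. cmod (s - a)) \<le> (\<Prod>a\<in>Z. 2 * real N)"
      proof (intro prod_mono conjI)
        fix a assume "a \<in> Z"
        then show "cmod (s - a) \<le> 2 * real N"
          using norm_triangle_ineq4[of s a] Zle[of a] N by linarith
      qed simp
      then show ?thesis unfolding prod_norm prod_constant cZ .
    qed
    ultimately have "cmod (f s) \<le> (2 * real N) ^ (2 * N + 1) * ?B"
      unfolding q(2)[of s] norm_mult by (intro mult_mono) auto
    also have "\<dots> = C * exp (2 / 5 * real N) * (2 / 3) ^ (2 * N + 1)"
    proof -
      have "(2 / 3 :: real) ^ (2 * N + 1) = (2 * real N / (3 * real N)) ^ (2 * N + 1)"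
        using N by (intro arg_cong[where f = "\<lambda>x. x ^ (2 * N + 1)"]) (simp add: field_simps)
      then show ?thesis unfolding power_divide by (simp only: times_divide_eq_right mult_ac)
    qed
    also have "\<dots> \<le> C * exp (2 / 5 * real N) * (4 / 9) ^ N"
    proof -
      have "(2 / 3 :: real) ^ (2 * N + 1) = (2/3) * (4 / 9) ^ N"
        by (simp add: power_mult power_divide)
      also have "\<dots> \<le> 1 * (4/9) ^ N" by (intro mult_right_mono) auto
      finally show ?thesis using C by (intro mult_left_mono) auto
    qed
    also have "\<dots> = C * (exp (2/5) * 4 / 9) ^ N"
      by (simp add: power_mult_distrib exp_of_nat_mult[symmetric] power_divide mult.commute)
    finally show ?thesis .
  qed
  \<comment> \<open>The type \<open>1/10\<close> enters here: the ratio of the geometric bound is at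
    most \<open>1.56 * 4/9\<close>, which is below 1.\<close>
  have "exp (2/5 :: real) \<le> 1 + 2/5 + (2/5)\<^sup>2" by (rule exp_bound) auto
  then have "exp (2/5 :: real) * 4 / 9 < 1" by (simp add: power2_eq_square)
  then have "(\<lambda>N. C * (exp (2/5) * 4 / 9) ^ N) \<longlonglongrightarrow> C * 0"
    by (intro tendsto_intros LIMSEQ_realpow_zero) auto
  moreover have "eventually (\<lambda>N. cmod (f s) \<le> C * (exp (2/5) * 4 / 9) ^ N) sequentially"
    using eventually_ge_at_top[of "max 1 (nat \<lceil>cmod s\<rceil>)"]
    by eventually_elim (intro est, linarith+)
  ultimately have "cmod (f s) \<le> C * 0"
    by (intro tendsto_lowerbound) auto
  then show ?thesis by simp
qed

text \<open>Holomorphy along each complex line is the only form of holomorphy in several variables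
  that the argument calls for: Carlson's theorem and the continuation from real points are both
  applied one complex parameter at a time.\<close>

definition entire_on_lines :: "(complex ^ 'n \<Rightarrow> complex) \<Rightarrow> bool" where
  "entire_on_lines f \<longleftrightarrow> (\<forall>u v. (\<lambda>s. f (u + s *s v)) holomorphic_on UNIV)"

text \<open>Induction on the set \<open>S\<close> of coordinates released from being integers. As a
  function of a newly released coordinate, \<open>f\<close> vanishes at the integers by the
  induction hypothesis, and the other coordinates enter the growth bound only through a constant
  factor.\<close>

lemma carlson_lattice:
  fixes f :: "complex ^ 'n::finite \<Rightarrow> complex"
  assumes holf: "entire_on_lines f"
    and bnd: "\<And>z. cmod (f z) \<le> C * exp (norm z / 10)"
    and zero: "\<And>z. (\<And>i. z $ i \<in> \<int>) \<Longrightarrow> f z = 0"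
  shows "f z = 0"
proof -
  have C: "C \<ge> 0"
    using order_trans[OF norm_ge_zero bnd[of 0]] by simp
  have "\<forall>z. (\<forall>i. i \<notin> S \<longrightarrow> z $ i \<in> \<int>) \<longrightarrow> f z = 0" for S
  proof (induction S rule: infinite_finite_induct)
    case (insert j S)
    show ?case
    proof safe
      fix z :: "complex ^ 'n"
      assume z: "\<forall>i. i \<notin> insert j S \<longrightarrow> z $ i \<in> \<int>"
      let ?u = "\<chi> i. if i = j then 0 else z $ i"
      let ?g = "\<lambda>s. f (?u + s *s axis j 1)"
      have "?g (z $ j) = 0"
      proof (rule carlson_small_type[of ?g])
        show "(\<lambda>s. f (?u + s *s axis j 1)) holomorphic_on UNIV"
          using holf unfolding entire_on_lines_def by blast
        show "cmod (?g s) \<le> (C * exp (norm ?u / 10)) * exp (cmod s / 10)" for s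
        proof -
          have "s *s axis j 1 = (axis j s :: complex ^ 'n)"
            by (simp add: vec_eq_iff axis_def)
          then have "norm (s *s axis j 1 :: complex ^ 'n) = cmod s"
            by (simp add: norm_vec_def L2_set_def axis_def if_distrib[of norm]
              if_distrib[of "\<lambda>x. x ^ 2"] cong: if_cong)
          then have "norm (?u + s *s axis j 1) \<le> norm ?u + cmod s"
            using norm_triangle_ineq[of ?u "s *s axis j 1"] by simp
          then have "C * exp (norm (?u + s *s axis j 1) / 10) \<le> C * exp ((norm ?u + cmod s) / 10)"
            using C by (intro mult_left_mono) auto
          then show ?thesis using bnd[of "?u + s *s axis j 1"]
            by (simp add: add_divide_distrib exp_add)
        qed
        show "?g (of_int k) = 0" for k
          using insert.IH z by (auto simp: axis_def)
      qed
      moreover have "?u + z $ j *s axis j 1 = z"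
        by (auto simp: vec_eq_iff axis_def)
      ultimately show "f z = 0" by simp
    qed
  qed (use zero in auto)
  from this[of UNIV] show ?thesis by simp
qed

section \<open>Complexified vectors and continuation from real points\<close>

definition cvec :: "real ^ 'n \<Rightarrow> complex ^ 'n" where
  "cvec x = (\<chi> i. complex_of_real (x $ i))"

lemma cvec_nth [simp]: "cvec x $ i = complex_of_real (x $ i)"
  by (simp add: cvec_def)

text \<open>With \<open>z = a + i b\<close>, the complex line through \<open>a\<close> in direction
  \<open>b\<close> carries real vectors at all real parameters and \<open>z\<close> at the parameter
  \<open>\<i>\<close>; the identity theorem in one variable connects the two.\<close>

lemma entire_on_lines_eq_0:
  fixes f :: "complex ^ 'n::finite \<Rightarrow> complex"
  assumes holf: "entire_on_lines f" and zero: "\<And>x. f (cvec x) = 0"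
  shows "f z = 0"
proof -
  let ?a = "\<chi> i. Re (z $ i)" and ?b = "\<chi> i. Im (z $ i)"
  let ?g = "\<lambda>s. f (cvec ?a + s *s cvec ?b)"
  have "?g \<i> = 0"
  proof (rule analytic_continuation[of ?g UNIV "of_real ` UNIV" 0])
    show "?g holomorphic_on UNIV" using holf by (simp add: entire_on_lines_def)
    show "0 islimpt (range complex_of_real)"
    proof (rule islimpt_subset)
      have "(\<lambda>n. complex_of_real (1 / real (Suc n))) \<longlonglongrightarrow> complex_of_real 0"
        by (intro tendsto_of_real LIMSEQ_Suc lim_1_over_n)
      then show "0 islimpt (range (\<lambda>n. complex_of_real (1 / real (Suc n))))"
        unfolding islimpt_sequential
        by (intro exI[of _ "\<lambda>n. complex_of_real (1 / real (Suc n))"] conjI allI DiffI rangeI)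
          (simp_all del: of_nat_Suc)
    qed blast
    fix s assume "s \<in> range complex_of_real"
    then obtain r where r: "s = of_real r" by blast
    have "cvec ?a + s *s cvec ?b = cvec (?a + r *\<^sub>R ?b)"
      by (simp add: vec_eq_iff r)
    then show "?g s = 0" using zero by simp
  qed auto
  moreover have "cvec ?a + \<i> *s cvec ?b = z"
    by (simp add: vec_eq_iff complex_eq_iff)
  ultimately show ?thesis by simp
qed

text \<open>The exponential series may be integrated termwise, because
  \<open>cmod (g t) * exp (cmod s * cmod (w t))\<close> dominates it. The result is a power series
  around 0 that converges everywhere.\<close>

lemma entire_exp_integral:
  fixes g w :: "'a \<Rightarrow> complex"
  assumes [measurable]: "g \<in> borel_measurable M" "w \<in> borel_measurable M"
    and int: "\<And>r. integrable M (\<lambda>t. cmod (g t) * exp (r * cmod (w t)))"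
  shows "(\<lambda>s. LINT t|M. g t * exp (s * w t)) holomorphic_on UNIV"
proof -
  have "(\<lambda>k. (LINT t|M. g t * (w t ^ k / fact k)) * (s - 0) ^ k) sums (LINT t|M. g t * exp (s * w t))" for s
  proof -
    let ?f = "\<lambda>k t. g t * (s * w t) ^ k / fact k"
    have sm: "summable (\<lambda>k. norm (?f k t))" for t
    proof -
      have "norm (?f k t) = cmod (g t) * norm ((s * w t) ^ k /\<^sub>R fact k)" for k
        by (simp add: norm_mult norm_divide norm_inverse divide_inverse)
      then show ?thesis
        by (simp only:) (intro summable_mult summable_norm_exp)
    qed
    \<comment> \<open>This bound serves twice: a single term lies below a partial sum and is
      therefore integrable, and the integrals of the partial sums stay bounded.\<close>
    have le: "(\<Sum>k<n. norm (?f k t)) \<le> cmod (g t) * exp (cmod s * cmod (w t))" for n t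
    proof -
      have e: "(\<lambda>k. (cmod s * cmod (w t)) ^ k /\<^sub>R fact k) sums exp (cmod s * cmod (w t))"
        by (rule exp_converges)
      have "(\<Sum>k<n. norm (?f k t)) = cmod (g t) * (\<Sum>k<n. (cmod s * cmod (w t)) ^ k /\<^sub>R fact k)"
        by (simp add: sum_distrib_left norm_mult norm_divide norm_power norm_inverse divide_inverse mult_ac)
      also have "\<dots> \<le> cmod (g t) * (\<Sum>k. (cmod s * cmod (w t)) ^ k /\<^sub>R fact k)"
        using e by (intro mult_left_mono sum_le_suminf) (auto simp: sums_iff)
      finally show ?thesis using e by (simp add: sums_iff)
    qed
    have i: "integrable M (?f k)" for k
    proof (rule Bochner_Integration.integrable_bound[OF int[of "cmod s"]])
      have "norm (?f k t) \<le> norm (cmod (g t) * exp (cmod s * cmod (w t)))" for t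
      proof -
        have "norm (?f k t) \<le> (\<Sum>k<Suc k. norm (?f k t))"
          by (rule member_le_sum) auto
        also note le[where n = "Suc k"]
        finally show ?thesis by simp
      qed
      then show "AE t in M. norm (?f k t) \<le> norm (cmod (g t) * exp (cmod s * cmod (w t)))"
        by (intro always_eventually allI)
    qed measurable
    have "summable (\<lambda>k. LINT t|M. norm (?f k t))"
    proof (rule summableI_nonneg_bounded)
      fix n
      have "(\<Sum>k<n. LINT t|M. norm (?f k t)) = (LINT t|M. (\<Sum>k<n. norm (?f k t)))"
        using i by (intro Bochner_Integration.integral_sum[symmetric] integrable_norm) auto
      also have "\<dots> \<le> (LINT t|M. cmod (g t) * exp (cmod s * cmod (w t)))"
        using i le int by (intro integral_mono Bochner_Integration.integrable_sum integrable_norm) auto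
      finally show "(\<Sum>k<n. LINT t|M. norm (?f k t)) \<le> (LINT t|M. cmod (g t) * exp (cmod s * cmod (w t)))" .
    qed auto
    then have "(\<lambda>k. integral\<^sup>L M (?f k)) sums (LINT t|M. (\<Sum>k. ?f k t))"
      using i sm by (intro sums_integral) auto
    moreover have "(\<Sum>k. ?f k t) = g t * exp (s * w t)" for t
    proof -
      have "(\<lambda>k. g t * ((s * w t) ^ k /\<^sub>R fact k)) sums (g t * exp (s * w t))"
        by (intro sums_mult exp_converges)
      then show ?thesis by (simp add: sums_iff scaleR_conv_of_real divide_inverse mult_ac)
    qed
    moreover have "integral\<^sup>L M (?f k) = (LINT t|M. g t * (w t ^ k / fact k)) * (s - 0) ^ k" for k
      by (subst integral_mult_left_zero[symmetric]) (simp add: power_mult_distrib mult_ac)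
    ultimately show ?thesis by simp
  qed
  then have hol: "(\<lambda>s. LINT t|M. g t * exp (s * w t)) holomorphic_on ball 0 r" for r
    by (rule power_series_holomorphic)
  show ?thesis
    unfolding holomorphic_on_open[OF open_UNIV]
  proof
    fix s :: complex
    have "s \<in> ball 0 (cmod s + 1)" by simp
    then show "\<exists>f'. ((\<lambda>s. LINT t|M. g t * exp (s * w t)) has_field_derivative f') (at s)"
      using hol[of "cmod s + 1"] unfolding holomorphic_on_open[OF open_ball] by blast
  qed
qed

section \<open>Uniqueness of Fourier transforms\<close>

text \<open>A dictionary between weighted integrals and probability theory: the weight
  \<open>p\<close>, pushed forward along \<open>X\<close>, becomes a distribution to which Levy's
  uniqueness theorem applies.\<close>

lemma real_distribution_density:
  fixes p X :: "'a \<Rightarrow> real"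
  assumes p: "integrable M p" "\<And>t. 0 \<le> p t" "integral\<^sup>L M p = 1" and X: "X \<in> borel_measurable M"
  defines "D \<equiv> distr (density M p) borel X"
  shows "real_distribution D"
    and "char D w = (LINT t|M. complex_of_real (p t) * cis (w * X t))"
    and "B \<in> sets borel \<Longrightarrow> measure D B = (LINT t|M. p t * indicator B (X t))"
proof -
  note [measurable] = X borel_measurable_integrable[OF p(1)]
  have "emeasure (density M p) (space (density M p)) = 1"
    using p by (simp add: emeasure_density nn_integral_eq_integral cong: nn_integral_cong)
  then interpret P: prob_space "density M p" by (rule prob_spaceI)
  have "X \<in> borel_measurable (density M p)" by simp
  from P.real_distribution_distr[OF this] show D: "real_distribution D"
    unfolding D_def .
  then interpret D: real_distribution D .
  have "char D w = (LINT t|density M p. iexp (w * X t))"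
    unfolding char_def D_def by (subst integral_distr) auto
  also have "\<dots> = (LINT t|M. p t *\<^sub>R iexp (w * X t))"
    using p by (subst integral_density) auto
  finally show "char D w = (LINT t|M. complex_of_real (p t) * cis (w * X t))"
    by (simp add: cis_conv_exp scaleR_conv_of_real)
  show "measure D B = (LINT t|M. p t * indicator B (X t))" if [measurable]: "B \<in> sets borel"
  proof -
    have "measure D B = (LINT x|D. indicator B x)"
      using that by simp
    also have "\<dots> = (LINT t|density M p. indicator B (X t))"
      unfolding D_def by (subst integral_distr) auto
    also have "\<dots> = (LINT t|M. p t *\<^sub>R indicator B (X t))"
      using p by (subst integral_density) auto
    finally show ?thesis by simp
  qed
qed

text \<open>The positive and negative parts of \<open>k\<close> have the same transform along
  \<open>X\<close>. Normalised and pushed forward, they are two probability distributions with one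
  characteristic function, hence equal by Levy.\<close>

lemma integral_indicator_eq_0_real:
  fixes k X :: "'a \<Rightarrow> real"
  assumes k: "integrable M k" and X: "X \<in> borel_measurable M"
    and zero: "\<And>w. (LINT t|M. complex_of_real (k t) * cis (w * X t)) = 0" and B: "B \<in> sets borel"
  shows "(LINT t|M. k t * indicator B (X t)) = 0"
proof -
  note [measurable] = X borel_measurable_integrable[OF k] B
  define p where "p t = max 0 (k t)" for t
  define m where "m t = max 0 (- k t)" for t
  have kpm: "k t = p t - m t" for t by (auto simp: p_def m_def)
  have p: "integrable M p" "\<And>t. 0 \<le> p t" and m: "integrable M m" "\<And>t. 0 \<le> m t"
    unfolding p_def m_def using k by auto
  note [measurable] = borel_measurable_integrable[OF p(1)] borel_measurable_integrable[OF m(1)]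
  have ii: "integrable M (\<lambda>t. q t * indicator B (X t))" if "integrable M q" for q :: "'a \<Rightarrow> real"
    using that by (rule Bochner_Integration.integrable_bound)
      (use borel_measurable_integrable[OF that] in \<open>auto simp: indicator_def\<close>)
  have ic: "integrable M (\<lambda>t. complex_of_real (q t) * cis (w * X t))" if "integrable M q" for q w
    using that by (rule Bochner_Integration.integrable_bound)
      (use borel_measurable_integrable[OF that] in \<open>auto simp: norm_mult cis_conv_exp\<close>)
  have cpm: "(LINT t|M. complex_of_real (p t) * cis (w * X t)) = (LINT t|M. complex_of_real (m t) * cis (w * X t))" for w
    using zero[of w] ic[OF p(1), of w] ic[OF m(1), of w]
    by (simp add: kpm left_diff_distrib)
  define c where "c = integral\<^sup>L M p"
  \<comment> \<open>Frequency 0 compares the total masses, so a single constant normalises both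
    parts.\<close>
  have cm: "c = integral\<^sup>L M m"
    using cpm[of 0] by (simp add: c_def del: of_real_eq_iff flip: of_real_eq_iff[where 'a = complex])
  have "c \<ge> 0" unfolding c_def using p by (intro integral_nonneg_AE) auto
  have "(LINT t|M. p t * indicator B (X t)) = (LINT t|M. m t * indicator B (X t))"
  proof (cases "c = 0")
    \<comment> \<open>Without mass there is nothing to normalise, but then both parts vanish almost
      everywhere.\<close>
    case True
    have "AE t in M. p t = 0" "AE t in M. m t = 0"
      using True p m integral_nonneg_eq_0_iff_AE[of M p] integral_nonneg_eq_0_iff_AE[of M m]
      by (simp_all only: c_def[symmetric] cm[symmetric]) auto
    then show ?thesis
      by (intro integral_cong_AE) auto
  next
    case False
    let ?D = "\<lambda>q. distr (density M (\<lambda>t. q t / c)) borel X"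
    have D: "real_distribution (?D q)"
      "char (?D q) w = (LINT t|M. complex_of_real (q t) * cis (w * X t)) / c"
      "measure (?D q) B = (LINT t|M. q t * indicator B (X t)) / c"
      if q: "integrable M q" "\<And>t. 0 \<le> q t" "integral\<^sup>L M q = c" for q w
    proof -
      have *: "integrable M (\<lambda>t. q t / c)" "\<And>t. 0 \<le> q t / c" "(LINT t|M. q t / c) = 1"
        using q \<open>c \<ge> 0\<close> False by auto
      show "real_distribution (?D q)" by (rule real_distribution_density[OF * X])
      show "char (?D q) w = (LINT t|M. complex_of_real (q t) * cis (w * X t)) / c"
        unfolding real_distribution_density(2)[OF * X]
        by (subst Bochner_Integration.integral_divide_zero[symmetric]) simp
      show "measure (?D q) B = (LINT t|M. q t * indicator B (X t)) / c"
        using real_distribution_density(3)[OF * X B] by simp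
    qed
    note Dp = D[OF p c_def[symmetric]] and Dm = D[OF m cm[symmetric]]
    have "?D p = ?D m"
      by (rule Levy_uniqueness[OF Dp(1) Dm(1)]) (simp only: fun_eq_iff Dp(2) Dm(2) cpm simp_thms)
    then have "measure (?D p) B = measure (?D m) B" by simp
    then show ?thesis
      unfolding Dp(3) Dm(3) using False by simp
  qed
  then show ?thesis
    using ii[OF p(1)] ii[OF m(1)] by (simp add: kpm left_diff_distrib)
qed

text \<open>Conjugation replaces \<open>w\<close> by \<open>- w\<close>, so the transform of
  \<open>cnj k\<close> vanishes as well, and with it those of the real and imaginary parts of
  \<open>k\<close>, which the real case settles.\<close>

lemma integral_indicator_eq_0:
  fixes k :: "'a \<Rightarrow> complex" and X :: "'a \<Rightarrow> real"
  assumes k: "integrable M k" and X: "X \<in> borel_measurable M"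
    and zero: "\<And>w. (LINT t|M. k t * cis (w * X t)) = 0" and B: "B \<in> sets borel"
  shows "(LINT t|M. k t * indicator B (X t)) = 0"
proof -
  note [measurable] = X borel_measurable_integrable[OF k] B
  have i: "integrable M (\<lambda>t. k t * cis (w * X t))" for w
    using k by (rule Bochner_Integration.integrable_bound) (auto simp: norm_mult cis_conv_exp)
  have cz: "(LINT t|M. cnj (k t) * cis (w * X t)) = 0" and ci: "integrable M (\<lambda>t. cnj (k t) * cis (w * X t))" for w
  proof -
    have *: "(\<lambda>t. cnj (k t) * cis (w * X t)) = (\<lambda>t. cnj (k t * cis (- w * X t)))"
      by (simp add: cis_cnj)
    show "(LINT t|M. cnj (k t) * cis (w * X t)) = 0"
      unfolding * by (subst Bochner_Integration.integral_cnj) (simp only: zero complex_cnj_zero)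
    show "integrable M (\<lambda>t. cnj (k t) * cis (w * X t))"
      unfolding * using i[of "-w"] by (simp only: integrable_cnj)
  qed
  have "(LINT t|M. complex_of_real (Re (k t)) * cis (w * X t)) = 0" for w
  proof -
    have "complex_of_real (Re (k t)) * cis (w * X t) = (k t * cis (w * X t) + cnj (k t) * cis (w * X t)) / 2" for t
      by (simp add: complex_eq_iff)
    then show ?thesis using i ci zero cz by (simp only:) simp
  qed
  then have re: "(LINT t|M. Re (k t) * indicator B (X t)) = 0"
    using k X B by (intro integral_indicator_eq_0_real) auto
  have "(LINT t|M. complex_of_real (Im (k t)) * cis (w * X t)) = 0" for w
  proof -
    have "complex_of_real (Im (k t)) * cis (w * X t) = (k t * cis (w * X t) - cnj (k t) * cis (w * X t)) / (2 * \<i>)" for t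
      by (simp add: complex_eq_iff Re_divide Im_divide power2_eq_square)
    then show ?thesis using i ci zero cz by (simp only:) simp
  qed
  then have im: "(LINT t|M. Im (k t) * indicator B (X t)) = 0"
    using k X B by (intro integral_indicator_eq_0_real) auto
  have "integrable M (\<lambda>t. k t * indicator B (X t))"
    using k by (rule Bochner_Integration.integrable_bound) (auto simp: norm_mult indicator_def)
  note integral_Re[OF this] integral_Im[OF this]
  moreover have "Re (k t * indicator B (X t)) = Re (k t) * indicator B (X t)"
    "Im (k t * indicator B (X t)) = Im (k t) * indicator B (X t)" for t
    by (auto simp: indicator_def)
  ultimately show ?thesis
    using re im by (simp only: complex_eq_iff zero_complex.sel)
qed

text \<open>The characters are replaced by indicator functions one coordinate at a time, so that the
  one-dimensional uniqueness theorem of L\'evy applies.\<close>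

lemma integral_indicator_vec_eq_0:
  fixes h :: "real ^ 'n::finite \<Rightarrow> complex"
  assumes h: "integrable lborel h"
    and zero: "\<And>w. (LINT t|lborel. h t * cis (w \<bullet> t)) = 0"
    and B: "\<And>i. B i \<in> sets borel"
  shows "(LINT t|lborel. h t * (\<Prod>i\<in>S. indicator (B i) (t $ i)) * cis (\<Sum>i\<in>-S. w $ i * t $ i)) = 0"
proof (induction S arbitrary: w rule: infinite_finite_induct)
  case empty
  show ?case using zero[of w] by (simp add: inner_vec_def)
next
  case (insert j S)
  note [measurable] = borel_measurable_integrable[OF h] B
  let ?k = "\<lambda>t. h t * (\<Prod>i\<in>S. indicator (B i) (t $ i)) * cis (\<Sum>i\<in>-insert j S. w $ i * t $ i)"
  have [measurable]: "?k \<in> borel_measurable lborel" unfolding cis_conv_exp by measurable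
  have "(LINT t|lborel. ?k t * indicator (B j) (t $ j)) = 0"
  proof (rule integral_indicator_eq_0[OF _ _ _ B])
    show "integrable lborel ?k"
    proof (rule Bochner_Integration.integrable_bound[OF h])
      show "AE t in lborel. norm (?k t) \<le> norm (h t)"
        by (auto simp: norm_mult prod_norm[symmetric] indicator_def intro!: AE_I2 mult_left_le prod_le_1)
    qed fact
    fix s
    \<comment> \<open>Varying the \<open>j\<close>-th frequency alone turns the induction hypothesis
      into the vanishing of a one-dimensional transform of \<open>?k\<close> in
      \<open>t $ j\<close>.\<close>
    let ?w = "\<chi> i. if i = j then s else w $ i"
    have *: "-S = insert j (-insert j S)" using insert.hyps by auto
    have "(\<Sum>i\<in>-S. ?w $ i * t $ i) = (\<Sum>i\<in>-insert j S. w $ i * t $ i) + s * t $ j" for t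
      by (subst *) (auto simp: intro!: sum.cong)
    then show "(LINT t|lborel. ?k t * cis (s * t $ j)) = 0"
      using insert.IH[of ?w] by (simp add: cis_mult[symmetric] mult_ac)
  qed simp
  then show ?case
    using insert.hyps by (simp add: mult_ac)
qed simp

text \<open>Once every coordinate carries an indicator, \<open>h\<close> integrates to 0 over all
  boxes. These form an intersection-stable generator of the Borel sets, so Dynkin induction extends
  this to every Borel set.\<close>

lemma fourier_transform_eq_0_imp_AE_eq_0:
  fixes h :: "real ^ 'n::finite \<Rightarrow> complex"
  assumes h: "integrable lborel h"
    and zero: "\<And>w. (LINT t|lborel. h t * cis (w \<bullet> t)) = 0"
  shows "AE t in lborel. h t = 0"
proof (rule sigma_finite_measure.density_zero[OF sigma_finite_lborel h])
  fix A :: "(real ^ 'n) set" assume "A \<in> sets lborel"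
  then have "A \<in> sigma_sets UNIV (range (\<lambda>(a, b). box a b))"
    by (simp add: borel_eq_box)
  moreover have "Int_stable (range (\<lambda>(a, b). box a b :: (real ^ 'n) set))"
    by (auto simp: Int_stable_def box_Int_box)
  moreover have "range (\<lambda>(a, b). box a b :: (real ^ 'n) set) \<subseteq> Pow UNIV" by simp
  ultimately have "Int_stable (range (\<lambda>(a, b). box a b :: (real ^ 'n) set))"
    "range (\<lambda>(a, b). box a b :: (real ^ 'n) set) \<subseteq> Pow UNIV"
    "A \<in> sigma_sets UNIV (range (\<lambda>(a, b). box a b))" by blast+
  then show "(LINT t:A|lborel. h t) = 0"
  proof (induction rule: sigma_sets_induct_disjoint)
    case (basic A)
    then obtain a b :: "real ^ 'n" where A: "A = box a b" by auto
    have "(\<Prod>i\<in>UNIV. indicator {a $ i<..<b $ i} (t $ i)) = (indicator A t :: complex)" for t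
      by (auto simp: A indicator_def mem_box_cart prod_zero_iff)
    then show ?case
      using integral_indicator_vec_eq_0[OF h zero, of "\<lambda>i. {a $ i<..<b $ i}" UNIV]
      by (simp add: set_lebesgue_integral_def scaleR_conv_of_real mult_ac of_real_indicator)
  next
    case (compl A)
    then have A: "A \<in> sets lborel" by (simp add: borel_eq_box)
    have i: "integrable lborel (\<lambda>t. indicator A t *\<^sub>R h t)"
      using h A by (intro integrable_mult_indicator)
    \<comment> \<open>Complements rest on the total integral of \<open>h\<close>, which is the
      transform at frequency 0.\<close>
    have "(LINT t:UNIV - A|lborel. h t) = (LINT t|lborel. h t - indicator A t *\<^sub>R h t)"
      unfolding set_lebesgue_integral_def
      by (intro Bochner_Integration.integral_cong) (auto simp: indicator_def)
    also have "\<dots> = 0"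
      using h i compl zero[of 0] by (simp add: set_lebesgue_integral_def)
    finally show ?case .
  next
    case (union A)
    then have A: "A i \<in> sets lborel" for i by (auto simp: borel_eq_box)
    have "(LINT t:(\<Union>i. A i)|lborel. h t) = (\<Sum>i. LINT t:A i|lborel. h t)"
      using union(1) A h
      by (intro lebesgue_integral_countable_add) (auto simp: disjoint_family_on_def set_integrable_def
          intro!: integrable_mult_indicator)
    then show ?case using union by simp
  qed (auto simp: set_lebesgue_integral_def)
qed

section \<open>Fourier transforms of Gaussians\<close>

lemma lborel_integral_prod:
  fixes f :: "'a::euclidean_space \<Rightarrow> real \<Rightarrow> complex"
  assumes f: "\<And>b. b \<in> Basis \<Longrightarrow> integrable lborel (f b)"
  shows "(LINT t|lborel. (\<Prod>b\<in>Basis. f b (t \<bullet> b))) = (\<Prod>b\<in>Basis. integral\<^sup>L lborel (f b))"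
proof -
  interpret product_sigma_finite "\<lambda>_::'a. lborel :: real measure" ..
  have [measurable]: "f b \<in> borel_measurable borel" if "b \<in> Basis" for b
    using borel_measurable_integrable[OF f[OF that]] by simp
  have "(LINT t|lborel. (\<Prod>b\<in>Basis. f b (t \<bullet> b))) =
      (LINT x|(\<Pi>\<^sub>M b\<in>(Basis::'a set). lborel). (\<Prod>b\<in>Basis. f b ((\<Sum>c\<in>Basis. x c *\<^sub>R c) \<bullet> b)))"
    by (subst lborel_eq, subst integral_distr) (auto intro!: borel_measurable_prod)
  also have "\<dots> = (LINT x|(\<Pi>\<^sub>M b\<in>(Basis::'a set). lborel). (\<Prod>b\<in>Basis. f b (x b)))"
    by (intro Bochner_Integration.integral_cong prod.cong refl arg_cong2[where f = f])
      (simp add: inner_sum_left inner_Basis if_distrib cong: if_cong)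
  also have "\<dots> = (\<Prod>b\<in>Basis. integral\<^sup>L lborel (f b))"
    by (rule product_integral_prod) (auto intro: f)
  finally show ?thesis .
qed

lemma integrable_gaussian_real: "integrable lborel (\<lambda>x::real. exp (- pi * x\<^sup>2 / 2))"
proof -
  have "integrable lborel (\<lambda>x::real. normal_density 0 (1 / sqrt pi) x)"
    by (rule integrable_normal_density) simp
  then have "integrable lborel (\<lambda>x::real. sqrt 2 * normal_density 0 (1 / sqrt pi) x)"
    by simp
  moreover have "sqrt 2 * normal_density 0 (1 / sqrt pi) x = exp (- pi * x\<^sup>2 / 2)" for x
    by (simp add: normal_density_def power_divide real_sqrt_divide)
  ultimately show ?thesis by simp
qed

lemma fourier_gaussian_real:
  "(LINT x|lborel. complex_of_real (exp (- pi * x\<^sup>2 / 2)) * cis (- 2 * pi * (x * w)))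
     = complex_of_real (sqrt 2 * exp (- 2 * pi * w\<^sup>2))"
proof -
  \<comment> \<open>The substitution \<open>y = sqrt pi * x\<close> turns the standard normal
    density into the Gaussian at hand; this frequency makes the phase
    \<open>- 2 * pi * (x * w)\<close>.\<close>
  let ?s = "- 2 * sqrt pi * w"
  have "complex_of_real (exp (- (?s\<^sup>2) / 2)) = char std_normal_distribution ?s"
    by (simp add: char_std_normal_distribution)
  also have "\<dots> = (LINT y|lborel. std_normal_density y *\<^sub>R iexp (?s * y))"
    unfolding char_def by (subst integral_density) auto
  also have "\<dots> = \<bar>sqrt pi\<bar> *\<^sub>R (LINT x|lborel. std_normal_density (0 + sqrt pi * x) *\<^sub>R iexp (?s * (0 + sqrt pi * x)))"
    by (rule lborel_integral_real_affine) simp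
  also have "\<dots> = \<bar>sqrt pi\<bar> *\<^sub>R (LINT x|lborel. (1 / sqrt (2 * pi)) *\<^sub>R
      (complex_of_real (exp (- pi * x\<^sup>2 / 2)) * cis (- 2 * pi * (x * w))))"
  proof -
    have "?s * (0 + sqrt pi * x) = - 2 * pi * (x * w)" for x
      by simp
    moreover have "std_normal_density (0 + sqrt pi * x) = 1 / sqrt (2 * pi) * exp (- pi * x\<^sup>2 / 2)" for x
      by (simp add: std_normal_density_def power_mult_distrib)
    ultimately show ?thesis
      by (simp only: cis_conv_exp scaleR_conv_of_real of_real_mult mult.assoc)
  qed
  also have "\<dots> = complex_of_real (1 / sqrt 2) *
      (LINT x|lborel. complex_of_real (exp (- pi * x\<^sup>2 / 2)) * cis (- 2 * pi * (x * w)))"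
    by (simp add: real_sqrt_mult scaleR_conv_of_real)
  finally show ?thesis
    by (simp add: power_mult_distrib field_simps flip: of_real_mult)
qed

lemma fourier_gaussian:
  fixes w :: "'a::euclidean_space"
  shows "(LINT t|lborel. complex_of_real (exp (- pi * (t \<bullet> t) / 2)) * cis (- 2 * pi * (t \<bullet> w)))
     = complex_of_real (sqrt 2 ^ DIM('a) * exp (- 2 * pi * (w \<bullet> w)))"
proof -
  let ?f = "\<lambda>b x. complex_of_real (exp (- pi * x\<^sup>2 / 2)) * cis (- 2 * pi * (x * (w \<bullet> b)))"
  have i: "integrable lborel (?f b)" for b
    using integrable_gaussian_real
    by (rule Bochner_Integration.integrable_bound) (auto simp: norm_mult cis_conv_exp)
  have sq: "u \<bullet> u = (\<Sum>b\<in>Basis. (u \<bullet> b)\<^sup>2)" for u :: 'a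
    by (subst euclidean_inner) (simp add: power2_eq_square)
  have "complex_of_real (exp (- pi * (t \<bullet> t) / 2)) * cis (- 2 * pi * (t \<bullet> w)) = (\<Prod>b\<in>Basis. ?f b (t \<bullet> b))" for t
  proof -
    have "(\<Prod>b\<in>Basis. ?f b (t \<bullet> b)) = (\<Prod>b\<in>Basis. exp (of_real (- pi * (t \<bullet> b)\<^sup>2 / 2) + \<i> * of_real (- 2 * pi * ((t \<bullet> b) * (w \<bullet> b)))))"
      by (simp only: cis_conv_exp exp_of_real[symmetric] exp_add)
    also have "\<dots> = exp (\<Sum>b\<in>Basis. of_real (- pi * (t \<bullet> b)\<^sup>2 / 2) + \<i> * of_real (- 2 * pi * ((t \<bullet> b) * (w \<bullet> b))))"
      by (rule exp_sum[symmetric]) simp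
    also have "(\<Sum>b\<in>Basis. of_real (- pi * (t \<bullet> b)\<^sup>2 / 2) + \<i> * of_real (- 2 * pi * ((t \<bullet> b) * (w \<bullet> b))))
        = complex_of_real (- pi * (t \<bullet> t) / 2) + \<i> * complex_of_real (- 2 * pi * (t \<bullet> w))"
      unfolding sq euclidean_inner[of t w]
      by (simp only: sum.distrib sum_distrib_left sum_divide_distrib of_real_sum)
    finally show ?thesis
      by (simp only: cis_conv_exp exp_of_real[symmetric] exp_add)
  qed
  then have "(LINT t|lborel. complex_of_real (exp (- pi * (t \<bullet> t) / 2)) * cis (- 2 * pi * (t \<bullet> w)))
      = (\<Prod>b\<in>Basis. integral\<^sup>L lborel (?f b))"
    by (simp only: lborel_integral_prod[OF i])
  also have "\<dots> = (\<Prod>b\<in>(Basis::'a set). complex_of_real (sqrt 2 * exp (- 2 * pi * (w \<bullet> b)\<^sup>2)))"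
    by (simp only: fourier_gaussian_real)
  also have "\<dots> = complex_of_real (\<Prod>b\<in>(Basis::'a set). sqrt 2 * exp (- 2 * pi * (w \<bullet> b)\<^sup>2))"
    by simp
  also have "(\<Prod>b\<in>(Basis::'a set). sqrt 2 * exp (- 2 * pi * (w \<bullet> b)\<^sup>2)) = sqrt 2 ^ DIM('a) * exp (- 2 * pi * (w \<bullet> w))"
    unfolding sq by (simp add: prod.distrib exp_sum[symmetric] sum_distrib_left)
  finally show ?thesis .
qed

section \<open>Operators on square-integrable functions\<close>

lemma borel_measurable_cnj [measurable (raw)]:
  "f \<in> borel_measurable M \<Longrightarrow> (\<lambda>x. cnj (f x)) \<in> borel_measurable M"
  by (rule measurable_compose[OF _ borel_measurable_continuous_onI]) (auto intro: continuous_intros)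

lemma L2rel_self_iff [simp]: "L2rel f f \<longleftrightarrow> square_integrable f"
  by (simp add: L2rel_def)

lemma square_integrable_rep_L2: "square_integrable (rep_L2 f)"
  using Quotient_rep_reflp[OF Quotient_L2, of f] by simp

lemma abs_rep_L2: "abs_L2 (rep_L2 f) = f"
  by (rule Quotient_abs_rep[OF Quotient_L2])

lemma rep_abs_L2:
  assumes "square_integrable f"
  shows "AE x in lborel. rep_L2 (abs_L2 f) x = f x"
proof -
  have "L2rel (rep_L2 (abs_L2 f)) f"
    using Quotient_rep_abs[OF Quotient_L2, of f] assms by simp
  then show ?thesis by (simp add: L2rel_def)
qed

lemma abs_L2_cong:
  assumes "square_integrable f" "square_integrable g" "AE x in lborel. f x = g x"
  shows "abs_L2 f = abs_L2 g"
  using assms by (intro Quotient_rel_abs[OF Quotient_L2]) (simp add: L2rel_def)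

lemma borel_measurable_rep_L2 [measurable]: "rep_L2 f \<in> borel_measurable borel"
  using square_integrable_rep_L2[of f] by (simp add: square_integrable_def)

lemma cinner_abs_L2_right:
  assumes "square_integrable g"
  shows "cinner f (abs_L2 g) = (LINT x|lborel. rep_L2 f x * cnj (g x))"
  using cinner.abs_eq[of "rep_L2 f" g] assms by (simp add: square_integrable_rep_L2 abs_rep_L2)

lemma rep_L2_diff: "AE x in lborel. rep_L2 (f - g) x = rep_L2 f x - rep_L2 g x"
  using minus_L2.abs_eq[of "rep_L2 f" "rep_L2 g"]
    rep_abs_L2[OF square_integrable_diff[OF square_integrable_rep_L2[of f] square_integrable_rep_L2[of g]]]
  by (simp add: square_integrable_rep_L2 abs_rep_L2)

lemma L2_eq_0_iff: "f = 0 \<longleftrightarrow> (AE x in lborel. rep_L2 f x = 0)"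
proof
  assume "f = 0"
  then show "AE x in lborel. rep_L2 f x = 0"
    using rep_abs_L2[OF square_integrable_zero] by (simp add: zero_L2_def)
next
  assume "AE x in lborel. rep_L2 f x = 0"
  then have "abs_L2 (rep_L2 f) = abs_L2 (\<lambda>x. 0)"
    by (intro abs_L2_cong square_integrable_rep_L2 square_integrable_zero)
  then show "f = 0" by (simp add: abs_rep_L2 zero_L2_def)
qed

lemma cinner_add_right: "cinner f (g + h) = cinner f g + cinner f h"
  by (subst (1 2 3) cinner_commute) (simp add: cinner_add_left)

lemma cinner_scaleC_right: "cinner f (c *\<^sub>C g) = cnj c * cinner f g"
  by (subst (1 2) cinner_commute) (simp add: cinner_scaleC_left)

lemma cinner_diff_left: "cinner (f - g) h = cinner f h - cinner g h"
  using cinner_add_left[of "f - g" g h] by simp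

lemma cinner_diff_right: "cinner f (g - h) = cinner f g - cinner f h"
  using cinner_add_right[of f "g - h" h] by simp

lemma cinner_eq_0_imp_eq_0: "cinner f f = 0 \<Longrightarrow> f = 0"
  using cinner_self(2)[of f] by simp

lemma norm_scaleC: "norm (c *\<^sub>C f) = cmod c * norm f"
proof -
  have "cinner (c *\<^sub>C f) (c *\<^sub>C f) = (complex_of_real (cmod c))\<^sup>2 * cinner f f"
    using complex_norm_square[of c] by (simp add: cinner_scaleC_left cinner_scaleC_right)
  then have "Re (cinner (c *\<^sub>C f) (c *\<^sub>C f)) = (cmod c)\<^sup>2 * Re (cinner f f)"
    by (simp flip: of_real_power)
  then show ?thesis
    by (simp add: norm_L2_def inner_L2_def real_sqrt_mult)
qed

text \<open>A unimodular factor \<open>c\<close> makes the inner product real and nonnegative, so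
  the real Cauchy-Schwarz inequality suffices.\<close>

lemma norm_cinner_le: "cmod (cinner f g) \<le> norm f * norm g"
proof (cases "cinner f g = 0")
  case False
  define c where "c = cnj (cinner f g) / cmod (cinner f g)"
  have "cmod c = 1" using False by (simp add: c_def norm_divide)
  have "cinner (c *\<^sub>C f) g = cmod (cinner f g)"
    using False by (simp add: c_def cinner_scaleC_left complex_norm_square[symmetric] power2_eq_square mult.commute)
  then have "cmod (cinner f g) = inner (c *\<^sub>C f) g"
    by (simp add: inner_L2_def)
  also have "\<dots> \<le> norm (c *\<^sub>C f) * norm g" by (rule norm_cauchy_schwarz)
  finally show ?thesis by (simp add: norm_scaleC \<open>cmod c = 1\<close>)
qed simp

lemma bounded_linear_cinner_left: "bounded_linear (\<lambda>f. cinner f g)"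
proof (rule bounded_linear_intro[where K = "norm g"])
  show "cinner (f + h) g = cinner f g + cinner h g" for f h
    by (rule cinner_add_left)
  show "cinner (r *\<^sub>R f) g = r *\<^sub>R cinner f g" for r f
    by (simp add: scaleR_L2_def cinner_scaleC_left scaleR_conv_of_real)
  show "norm (cinner f g) \<le> norm f * norm g" for f
    by (rule norm_cinner_le)
qed

text \<open>Nondegeneracy of the inner product makes an adjoint unique, which resolves the definite
  description in \<open>cadjoint\<close>.\<close>

lemma cadjoint_eqI:
  assumes "\<And>f g. cinner (T f) g = cinner f (T' g)"
  shows "cadjoint T = T'"
  unfolding cadjoint_def
proof (rule the_equality)
  fix T'' assume T'': "\<forall>f g. cinner (T f) g = cinner f (T'' g)"
  show "T'' = T'"
  proof
    fix g
    have "cinner h (T'' g) = cinner h (T' g)" for h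
      using assms[of h g] T''[rule_format, of h g] by simp
    then have "cinner (T'' g - T' g) (T'' g - T' g) = 0"
      by (simp add: cinner_diff_right)
    then show "T'' g = T' g" using cinner_eq_0_imp_eq_0 by fastforce
  qed
qed (use assms in auto)

text \<open>The sum over the basis is the expansion of \<open>g\<close> with the bounded functional
  \<open>h \<mapsto> cinner (T h) f\<close> applied termwise. The value therefore does not involve
  the basis.\<close>

lemma hs_inner_rank_one:
  assumes T: "T \<in> hilbert_schmidt"
  shows "hs_inner T (f \<otimes>\<^sub>H g) = cinner (T g) f"
proof -
  define B where "B = (SOME B :: 'a L2 set. orthonormal_basis B)"
  \<comment> \<open>Membership in \<open>hilbert_schmidt\<close> provides an orthonormal basis, so
    the choice in \<open>hs_inner\<close> really selects one.\<close>
  have "\<exists>B :: 'a L2 set. orthonormal_basis B"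
    using T by (auto simp: hilbert_schmidt_def)
  then have B: "orthonormal_basis B" unfolding B_def by (rule someI_ex)
  have bl: "bounded_linear T" and sc: "T (c *\<^sub>C h) = c *\<^sub>C T h" for c h
    using T by (auto simp: hilbert_schmidt_def cbounded_linear_def)
  have "((\<lambda>e. cinner g e *\<^sub>C e) has_sum g) B"
    using B by (simp add: orthonormal_basis_def)
  then have "((\<lambda>e. cinner (T (cinner g e *\<^sub>C e)) f) has_sum cinner (T g) f) B"
    by (intro has_sum_bounded_linear[OF bounded_linear_compose[OF bounded_linear_cinner_left bl]])
  moreover have "cinner (T (cinner g e *\<^sub>C e)) f = cinner (T e) ((f \<otimes>\<^sub>H g) e)" for e
    by (simp add: sc rank_one_def cinner_scaleC_left cinner_scaleC_right flip: cinner_commute)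
  ultimately show ?thesis
    unfolding hs_inner_def B_def[symmetric] by (simp add: infsumI)
qed

lemma
  assumes "unitary_op U"
  shows cadjoint_unitary: "cadjoint U = inv U" and inv_unitary: "inv U (U f) = f"
proof -
  have U: "surj U" "\<And>f g. cinner (U f) (U g) = cinner f g" and bl: "bounded_linear U"
    using assms by (auto simp: unitary_op_def cbounded_linear_def)
  have "inj U"
  proof
    fix f g assume "U f = U g"
    then have "U (f - g) = 0"
      using bl by (simp add: linear_diff bounded_linear.linear)
    then have "cinner (f - g) (f - g) = 0"
      using U(2)[of "f - g" "f - g"] linear_0[OF bounded_linear.linear[OF bounded_linear_cinner_left[of 0]]]
      by metis
    then show "f = g" using cinner_eq_0_imp_eq_0 by fastforce
  qed
  then show "inv U (U f) = f" by simp
  show "cadjoint U = inv U"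
    using U(2) surj_f_inv_f[OF U(1)] by (intro cadjoint_eqI) metis
qed

text \<open>The adjoint of a unitary is its inverse, so the conjugation identity becomes an identity
  between vectors.\<close>

lemma metaplectic_intertwines:
  assumes "is_metaplectic M U"
  shows "U (\<rho> \<xi> f) = \<rho> (M *v \<xi>) (U f)"
proof -
  have "(U \<circ> \<rho> \<xi> \<circ> cadjoint U) (U f) = \<rho> (M *v \<xi>) (U f)" and "unitary_op U"
    using assms by (auto simp: is_metaplectic_def)
  then show ?thesis
    by (simp add: cadjoint_unitary inv_unitary)
qed

section \<open>Time-frequency shifts and samples of Cohen's class\<close>

lemma square_integrable_time_freq_shift:
  assumes "square_integrable f"
  shows "square_integrable (\<lambda>t. cis (- pi * (freq z \<bullet> pos z)) * cis (2 * pi * (freq z \<bullet> t)) * f (t - pos z))"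
  using rel_funD[OF rel_funD[OF time_freq_shift.rsp refl], of f f z] assms
  by (simp only: L2rel_self_iff)

lemma time_freq_shift_rep:
  "\<rho> z f = abs_L2 (\<lambda>t. cis (- pi * (freq z \<bullet> pos z)) * cis (2 * pi * (freq z \<bullet> t)) * rep_L2 f (t - pos z))"
  using time_freq_shift.abs_eq[of "rep_L2 f" z] by (simp add: square_integrable_rep_L2 abs_rep_L2)

lemma pos_uminus [simp]: "pos (- z) = - pos z" and freq_uminus [simp]: "freq (- z) = - freq z"
  by (simp_all add: pos_def freq_def vec_eq_iff)

text \<open>The symmetric phase \<open>cis (- pi * (freq z \<bullet> pos z))\<close> in
  \<open>\<rho>\<close> is what lets the shifts by \<open>z\<close> and \<open>- z\<close> cancel
  without a leftover scalar.\<close>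

lemma time_freq_shift_inverse: "\<rho> z (\<rho> (- z) f) = f"
proof (transfer, goal_cases)
  case (1 z f)
  have "(\<lambda>t. cis (- pi * (freq z \<bullet> pos z)) * cis (2 * pi * (freq z \<bullet> t)) *
        (cis (- pi * (freq (- z) \<bullet> pos (- z))) * cis (2 * pi * (freq (- z) \<bullet> (t - pos z))) * f (t - pos z - pos (- z))))
      = f"
  proof
    fix t
    have *: "cis a * cis b * (cis c * cis d * x) = x" if "a + b + (c + d) = 0" for a b c d x
    proof -
      have "cis a * cis b * (cis c * cis d * x) = cis (a + b + (c + d)) * x"
        by (simp only: cis_mult[symmetric] mult.assoc)
      with that show ?thesis by simp
    qed
    have "- pi * (freq z \<bullet> pos z) + 2 * pi * (freq z \<bullet> t) +
        (- pi * (freq (- z) \<bullet> pos (- z)) + 2 * pi * (freq (- z) \<bullet> (t - pos z))) = 0"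
      by (simp add: inner_diff_right right_diff_distrib)
    from *[OF this] show "cis (- pi * (freq z \<bullet> pos z)) * cis (2 * pi * (freq z \<bullet> t)) *
        (cis (- pi * (freq (- z) \<bullet> pos (- z))) * cis (2 * pi * (freq (- z) \<bullet> (t - pos z))) * f (t - pos z - pos (- z)))
      = f t"
      by simp
  qed
  then show ?case using 1 by (simp only:)
qed

lemma cinner_time_freq_shift: "cinner (\<rho> z f) (\<rho> z g) = cinner f g"
proof (transfer, goal_cases)
  case (1 z f g)
  have [measurable]: "f \<in> borel_measurable borel" "g \<in> borel_measurable borel"
    using 1 by (auto simp: square_integrable_def)
  have c: "cis a * cis b * x * cnj (cis a * cis b * y) = x * cnj y" for a b x y
  proof -
    have "cis a * cis b * x * cnj (cis a * cis b * y) = cis (a + b + (- a + - b)) * (x * cnj y)"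
      by (simp only: cis_mult[symmetric] cis_cnj[symmetric] complex_cnj_mult mult_ac)
    then show ?thesis by simp
  qed
  have "(LINT t|lborel. f (t - pos z) * cnj (g (t - pos z))) = (LINT t|distr lborel borel ((+) (- pos z)). f t * cnj (g t))"
    by (subst integral_distr) auto
  then show ?case by (simp only: c lborel_distr_plus)
qed

lemma cinner_time_freq_shift_left: "cinner (\<rho> z f) g = cinner f (\<rho> (- z) g)"
  using cinner_time_freq_shift[of z f "\<rho> (- z) g"] by (simp only: time_freq_shift_inverse)

lemma cadjoint_time_freq_shift: "cadjoint (\<rho> z) = \<rho> (- z)"
  by (rule cadjoint_eqI) (rule cinner_time_freq_shift_left)

lemma norm_time_freq_shift: "norm (\<rho> z f) = norm f"
  by (simp add: norm_L2_def inner_L2_def cinner_time_freq_shift)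

lemma time_freq_shift_scaleC: "\<rho> z (c *\<^sub>C f) = c *\<^sub>C \<rho> z f"
proof (transfer, goal_cases)
  case (1 z c f)
  then have "square_integrable f" by simp
  from square_integrable_scale[OF square_integrable_time_freq_shift[OF this, of z], of c]
  show ?case
    unfolding L2rel_self_iff[symmetric] by (simp only: mult_ac)
qed

lemma op_shift_rank_one: "op_shift z (f \<otimes>\<^sub>H g) = \<rho> z f \<otimes>\<^sub>H \<rho> z g"
proof
  fix h
  have "cinner (\<rho> (- z) h) g = cinner h (\<rho> z g)"
    by (simp only: cinner_time_freq_shift_left minus_minus)
  then show "op_shift z (f \<otimes>\<^sub>H g) h = (\<rho> z f \<otimes>\<^sub>H \<rho> z g) h"
    by (simp add: op_shift_def cadjoint_time_freq_shift rank_one_def time_freq_shift_scaleC)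
qed

lemma cohen_diag_gaussian_window:
  assumes "T \<in> hilbert_schmidt"
  shows "cohen_diag gaussian_window T z = cinner (T (\<rho> z gaussian)) (\<rho> z gaussian)"
  using assms by (simp add: cohen_diag_def gaussian_window_def op_shift_rank_one hs_inner_rank_one)

text \<open>Places the samples in \<open>ell_infty\<close>: all shifted Gaussians have the same norm
  and \<open>T\<close> is a bounded operator.\<close>

lemma bounded_range_cohen_diag:
  assumes T: "T \<in> hilbert_schmidt"
  shows "bounded (range (cohen_diag gaussian_window T))"
proof -
  from T have "bounded_linear T" by (simp add: hilbert_schmidt_def cbounded_linear_def)
  then obtain C where C: "\<And>f. norm (T f) \<le> norm f * C"
    using bounded_linear.bounded by blast
  have "cmod (cohen_diag gaussian_window T z) \<le> norm (gaussian :: (real ^ 'a) L2) * C * norm (gaussian :: (real ^ 'a) L2)" for z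
    unfolding cohen_diag_gaussian_window[OF T]
    using norm_cinner_le[of "T (\<rho> z gaussian)" "\<rho> z gaussian"]
      mult_right_mono[OF C[of "\<rho> z gaussian"] norm_ge_zero[of "\<rho> z gaussian"]]
    by (simp add: norm_time_freq_shift)
  then show ?thesis by (auto simp: bounded_iff)
qed

text \<open>The complement of the support is a union of possibly uncountably many open sets. By
  Lindelof countably many of them cover it, and their exceptional null sets add up to a null
  set.\<close>

lemma AE_L2_support: "AE x in lborel. x \<notin> L2_support f \<longrightarrow> rep_L2 f x = 0"
proof -
  let ?V = "{V. open V \<and> (AE x in lborel. x \<in> V \<longrightarrow> rep_L2 f x = 0)}"
  obtain F where F: "F \<subseteq> ?V" "countable F" "\<Union>F = \<Union>?V"
    by (rule Lindelof[of ?V]) auto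
  have "AE x in lborel. \<forall>V\<in>F. x \<in> V \<longrightarrow> rep_L2 f x = 0"
    using F by (subst AE_ball_countable) auto
  then show ?thesis
    by (rule eventually_mono) (use F(3) in \<open>auto simp: L2_support_def\<close>)
qed

section \<open>Laplace transforms\<close>

text \<open>No conjugation appears: the pairing must be complex linear in \<open>z\<close> for the
  Laplace transform to be holomorphic.\<close>

definition cdot :: "complex ^ 'n \<Rightarrow> real ^ 'n \<Rightarrow> complex" where
  "cdot z t = (\<Sum>i\<in>UNIV. z $ i * complex_of_real (t $ i))"

lemma cdot_add: "cdot (u + v) t = cdot u t + cdot v t"
  by (simp add: cdot_def sum.distrib distrib_right)

lemma cdot_diff: "cdot (u - v) t = cdot u t - cdot v t"
  by (simp add: cdot_def sum_subtractf left_diff_distrib)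

lemma cdot_smult: "cdot (c *s u) t = c * cdot u t"
  by (simp add: cdot_def sum_distrib_left mult.assoc)

lemma cdot_cvec: "cdot (cvec x) t = complex_of_real (x \<bullet> t)"
  by (simp add: cdot_def inner_vec_def)

lemma norm_cdot_le:
  fixes z :: "complex ^ 'n::finite"
  shows "cmod (cdot z t) \<le> real CARD('n) * norm z * norm t"
proof -
  have "cmod (cdot z t) \<le> (\<Sum>i\<in>UNIV. norm (z $ i * complex_of_real (t $ i)))"
    unfolding cdot_def by (rule norm_sum)
  also have "\<dots> \<le> (\<Sum>i\<in>(UNIV :: 'n set). norm z * norm t)"
  proof (rule sum_mono)
    fix i
    have "norm (t $ i) \<le> norm t" "norm (z $ i) \<le> norm z" by (rule Finite_Cartesian_Product.norm_nth_le)+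
    then show "norm (z $ i * complex_of_real (t $ i)) \<le> norm z * norm t"
      by (auto simp: norm_mult intro!: mult_mono)
  qed
  finally show ?thesis by simp
qed

lemma borel_measurable_cdot [measurable]: "cdot z \<in> borel_measurable borel"
  unfolding cdot_def by measurable

definition laplace :: "(real ^ 'n::finite \<Rightarrow> complex) \<Rightarrow> complex ^ 'n \<Rightarrow> complex" where
  "laplace h z = (LINT t|lborel. h t * exp (cdot z t))"

text \<open>Exactly the domination under which \<open>laplace h\<close> converges at every complex
  vector and expands along every complex line.\<close>

definition exp_moments :: "(real ^ 'n::finite \<Rightarrow> complex) \<Rightarrow> bool" where
  "exp_moments h \<longleftrightarrow> h \<in> borel_measurable borel \<and>
     (\<forall>r. integrable lborel (\<lambda>t. cmod (h t) * exp (r * norm t)))"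

lemma entire_on_lines_laplace:
  fixes h :: "real ^ 'n::finite \<Rightarrow> complex"
  assumes h: "exp_moments h"
  shows "entire_on_lines (laplace h)"
  unfolding entire_on_lines_def
proof (intro allI)
  fix u v :: "complex ^ 'n"
  have [measurable]: "h \<in> borel_measurable borel" using h by (simp add: exp_moments_def)
  have "(\<lambda>s. LINT t|lborel. (h t * exp (cdot u t)) * exp (s * cdot v t)) holomorphic_on UNIV"
  proof (rule entire_exp_integral)
    fix r
    let ?R = "real CARD('n) * norm u + \<bar>r\<bar> * (real CARD('n) * norm v)"
    show "integrable lborel (\<lambda>t. cmod (h t * exp (cdot u t)) * exp (r * cmod (cdot v t)))"
    proof (rule Bochner_Integration.integrable_bound)
      show "integrable lborel (\<lambda>t. cmod (h t) * exp (?R * norm t))"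
        using h unfolding exp_moments_def by blast
      have "cmod (h t * exp (cdot u t)) * exp (r * cmod (cdot v t)) \<le> cmod (h t) * exp (?R * norm t)" for t
      proof -
        have "Re (cdot u t) \<le> real CARD('n) * norm u * norm t"
          using complex_Re_le_cmod norm_cdot_le order_trans by blast
        moreover have "r * cmod (cdot v t) \<le> \<bar>r\<bar> * (real CARD('n) * norm v * norm t)"
          by (intro mult_mono norm_cdot_le) auto
        ultimately have "Re (cdot u t) + r * cmod (cdot v t) \<le> ?R * norm t"
          by (simp add: algebra_simps)
        then have "cmod (h t) * exp (Re (cdot u t) + r * cmod (cdot v t)) \<le> cmod (h t) * exp (?R * norm t)"
          by (intro mult_left_mono) auto
        then show ?thesis by (simp add: norm_mult exp_add mult.assoc)
      qed
      then show "AE t in lborel. norm (cmod (h t * exp (cdot u t)) * exp (r * cmod (cdot v t)))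
          \<le> norm (cmod (h t) * exp (?R * norm t))"
        by (intro AE_I2) (simp add: abs_mult)
    qed measurable
  qed measurable
  then show "(\<lambda>s. laplace h (u + s *s v)) holomorphic_on UNIV"
    by (simp add: laplace_def cdot_add cdot_smult exp_add mult.assoc)
qed

lemma entire_on_lines_compose:
  assumes "entire_on_lines f" and "\<And>u v s. g (u + s *s v) = g u + s *s g v"
  shows "entire_on_lines (\<lambda>z. f (g z))"
  using assms by (simp add: entire_on_lines_def)

text \<open>Half of the Gaussian decay absorbs \<open>exp (r * norm t)\<close> and the other half
  keeps the weight square integrable; its product with the square integrable \<open>f\<close> is
  then integrable.\<close>

lemma exp_moments_gaussian:
  fixes f :: "(real ^ 'n::finite) L2"
  shows "exp_moments (\<lambda>t. rep_L2 f t * complex_of_real (exp (- 2 * pi * (t \<bullet> t))))"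
  unfolding exp_moments_def
proof (intro conjI allI)
  fix r :: real
  let ?g = "\<lambda>t::real ^ 'n. complex_of_real (exp (- 2 * pi * (t \<bullet> t)) * exp (r * norm t))"
  \<comment> \<open>The cost of completing the square
    \<open>(sqrt pi * norm t - r / (2 * sqrt pi))\<^sup>2\<close>.\<close>
  let ?C = "exp (r\<^sup>2 / (4 * pi))"
  have "square_integrable ?g"
    unfolding square_integrable_def
  proof
    show "?g \<in> borel_measurable lborel" by measurable
    show "integrable lborel (\<lambda>t. (cmod (?g t))\<^sup>2)"
    proof (rule Bochner_Integration.integrable_bound)
      show "integrable lborel (\<lambda>t::real ^ 'n. (cmod (complex_of_real (?C * exp (- pi * (t \<bullet> t)))))\<^sup>2)"
        using square_integrable_gaussian[of ?C] unfolding square_integrable_def by blast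
      have "- 2 * pi * (t \<bullet> t) + r * norm t \<le> r\<^sup>2 / (4 * pi) + - pi * (t \<bullet> t)" for t :: "real ^ 'n"
      proof -
        have "0 \<le> (sqrt pi * norm t - r / (2 * sqrt pi))\<^sup>2" by simp
        also have "\<dots> = pi * (norm t)\<^sup>2 - r * norm t + r\<^sup>2 / (4 * pi)"
          by (simp add: power2_diff power_mult_distrib power_divide)
        finally show ?thesis by (simp add: dot_square_norm)
      qed
      then have "exp (- 2 * pi * (t \<bullet> t) + r * norm t) \<le> exp (r\<^sup>2 / (4 * pi) + - pi * (t \<bullet> t))" for t :: "real ^ 'n"
        by simp
      then have "\<bar>exp (- 2 * pi * (t \<bullet> t)) * exp (r * norm t)\<bar> \<le> \<bar>?C * exp (- pi * (t \<bullet> t))\<bar>" for t :: "real ^ 'n"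
        unfolding exp_add by simp
      then have "(cmod (?g t))\<^sup>2 \<le> (cmod (complex_of_real (?C * exp (- pi * (t \<bullet> t)))))\<^sup>2" for t
        unfolding norm_of_real by (intro power_mono) auto
      then show "AE t in lborel. norm ((cmod (?g t))\<^sup>2) \<le> norm ((cmod (complex_of_real (?C * exp (- pi * (t \<bullet> t)))))\<^sup>2)"
        by (intro AE_I2) (simp only: real_norm_def abs_power2)
    qed measurable
  qed
  from integrable_norm[OF square_integrable_mult_integrable[OF square_integrable_rep_L2[of f] this]]
  show "integrable lborel (\<lambda>t. cmod (rep_L2 f t * complex_of_real (exp (- 2 * pi * (t \<bullet> t)))) * exp (r * norm t))"
    by (simp add: norm_mult mult.assoc)
qed measurable

text \<open>Bounded support yields exponential type: where \<open>h\<close> is nonzero,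
  \<open>norm t\<close> is at most the absolute value of \<open>R\<close>, and the dimension factor
  comes from the coordinatewise estimate \<open>norm_cdot_le\<close>.\<close>

lemma
  fixes h :: "real ^ 'n::finite \<Rightarrow> complex"
  assumes h: "integrable lborel h" and R: "AE t in lborel. norm t > R \<longrightarrow> h t = 0"
  shows exp_moments_bounded_support: "exp_moments h"
    and norm_laplace_le: "cmod (laplace h z) \<le> (LINT t|lborel. cmod (h t)) * exp (real CARD('n) * \<bar>R\<bar> * norm z)"
proof -
  note [measurable] = borel_measurable_integrable[OF h]
  show "exp_moments h"
    unfolding exp_moments_def
  proof (intro conjI allI)
    fix r :: real
    show "integrable lborel (\<lambda>t. cmod (h t) * exp (r * norm t))"
    proof (rule Bochner_Integration.integrable_bound)
      show "integrable lborel (\<lambda>t. cmod (h t) * exp (\<bar>r\<bar> * \<bar>R\<bar>))"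
        using h by simp
      show "AE t in lborel. norm (cmod (h t) * exp (r * norm t)) \<le> norm (cmod (h t) * exp (\<bar>r\<bar> * \<bar>R\<bar>))"
        using R
      proof eventually_elim
        case (elim t)
        show ?case
        proof (cases "h t = 0")
          case False
          then have "norm t \<le> \<bar>R\<bar>" using elim by linarith
          then have "r * norm t \<le> \<bar>r\<bar> * \<bar>R\<bar>" by (intro mult_mono) auto
          then show ?thesis by (simp add: abs_mult mult_left_mono)
        qed simp
      qed
    qed measurable
  qed measurable
  have "cmod (laplace h z) \<le> (LINT t|lborel. cmod (h t * exp (cdot z t)))"
    unfolding laplace_def by (rule integral_norm_bound)
  also have "\<dots> \<le> (LINT t|lborel. cmod (h t) * exp (real CARD('n) * \<bar>R\<bar> * norm z))"
  proof (rule integral_mono_AE')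
    show "integrable lborel (\<lambda>t. cmod (h t) * exp (real CARD('n) * \<bar>R\<bar> * norm z))"
      using h by simp
    show "AE t in lborel. cmod (h t * exp (cdot z t)) \<le> cmod (h t) * exp (real CARD('n) * \<bar>R\<bar> * norm z)"
      using R
    proof eventually_elim
      case (elim t)
      show ?case
      proof (cases "h t = 0")
        case False
        then have "norm t \<le> \<bar>R\<bar>" using elim by linarith
        have "Re (cdot z t) \<le> real CARD('n) * norm z * norm t"
          using complex_Re_le_cmod norm_cdot_le order_trans by blast
        also have "\<dots> \<le> real CARD('n) * norm z * \<bar>R\<bar>"
          using \<open>norm t \<le> \<bar>R\<bar>\<close> by (intro mult_left_mono) auto
        finally show ?thesis by (simp add: norm_mult mult_left_mono mult_ac)
      qed simp
    qed
  qed auto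
  also have "\<dots> = (LINT t|lborel. cmod (h t)) * exp (real CARD('n) * \<bar>R\<bar> * norm z)"
    by simp
  finally show "cmod (laplace h z) \<le> (LINT t|lborel. cmod (h t)) * exp (real CARD('n) * \<bar>R\<bar> * norm z)" .
qed

section \<open>Sampling of coherent states\<close>

lemma square_integrable_symbol_gaussian:
  "square_integrable (\<lambda>t::'a::euclidean_space. complex_of_real (exp (- 2 * pi * (t \<bullet> t))))"
  unfolding square_integrable_def
proof
  show "integrable lborel (\<lambda>t::'a. (cmod (complex_of_real (exp (- 2 * pi * (t \<bullet> t)))))\<^sup>2)"
  proof (rule Bochner_Integration.integrable_bound)
    show "integrable lborel (\<lambda>t::'a. (cmod (complex_of_real (1 * exp (- pi * (t \<bullet> t)))))\<^sup>2)"
      using square_integrable_gaussian[of 1] unfolding square_integrable_def by blast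
    have "(cmod (complex_of_real (exp (- 2 * pi * (t \<bullet> t)))))\<^sup>2 \<le> (cmod (complex_of_real (1 * exp (- pi * (t \<bullet> t)))))\<^sup>2" for t :: 'a
      unfolding norm_of_real by (intro power_mono) auto
    then show "AE t::'a in lborel. norm ((cmod (complex_of_real (exp (- 2 * pi * (t \<bullet> t)))))\<^sup>2)
        \<le> norm ((cmod (complex_of_real (1 * exp (- pi * (t \<bullet> t)))))\<^sup>2)"
      by (intro AE_I2) (simp only: real_norm_def abs_power2)
  qed measurable
qed measurable

lift_definition symbol_gaussian :: "'a::euclidean_space L2"
  is "\<lambda>t. complex_of_real (exp (- 2 * pi * (t \<bullet> t)))"
  by (simp only: L2rel_self_iff square_integrable_symbol_gaussian)

lemma time_freq_shift_abs_L2: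
  assumes "square_integrable f"
  shows "\<rho> z (abs_L2 f) = abs_L2 (\<lambda>t. cis (- pi * (freq z \<bullet> pos z)) * cis (2 * pi * (freq z \<bullet> t)) * f (t - pos z))"
  using time_freq_shift.abs_eq[of f z] assms by simp

text \<open>A form of the Bargmann transform. Expanding the square in the shifted Gaussian leaves a
  factor in \<open>t\<close> that joins \<open>f\<close>, a factor in \<open>pos \<xi>\<close> that
  leaves the integral, and a cross term that merges with the modulation into one exponent linear in
  \<open>t\<close>.\<close>

lemma cinner_coherent_state:
  fixes f :: "(real ^ 'n::finite) L2"
  shows "cinner f (\<rho> \<xi> symbol_gaussian) =
    exp (\<i> * complex_of_real (pi * (freq \<xi> \<bullet> pos \<xi>)) - complex_of_real (2 * pi * (pos \<xi> \<bullet> pos \<xi>))) *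
    laplace (\<lambda>t. rep_L2 f t * complex_of_real (exp (- 2 * pi * (t \<bullet> t))))
      (complex_of_real (4 * pi) *s cvec (pos \<xi>) - (2 * pi * \<i>) *s cvec (freq \<xi>))"
proof -
  let ?x = "pos \<xi>" and ?w = "freq \<xi>"
  let ?g = "\<lambda>t. cis (- pi * (?w \<bullet> ?x)) * cis (2 * pi * (?w \<bullet> t)) * complex_of_real (exp (- 2 * pi * ((t - ?x) \<bullet> (t - ?x))))"
  have "square_integrable ?g"
    by (rule square_integrable_time_freq_shift[OF square_integrable_symbol_gaussian])
  then have "cinner f (\<rho> \<xi> symbol_gaussian) = (LINT t|lborel. rep_L2 f t * cnj (?g t))"
    unfolding symbol_gaussian_def time_freq_shift_abs_L2[OF square_integrable_symbol_gaussian]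
    by (rule cinner_abs_L2_right)
  also have "\<dots> = (LINT t|lborel. exp (\<i> * complex_of_real (pi * (?w \<bullet> ?x)) - complex_of_real (2 * pi * (?x \<bullet> ?x))) *
      ((rep_L2 f t * complex_of_real (exp (- 2 * pi * (t \<bullet> t)))) *
       exp (cdot (complex_of_real (4 * pi) *s cvec ?x - (2 * pi * \<i>) *s cvec ?w) t)))"
  proof (intro Bochner_Integration.integral_cong refl)
    fix t
    have "cnj (?g t) = exp (\<i> * complex_of_real (pi * (?w \<bullet> ?x)) + - (\<i> * complex_of_real (2 * pi * (?w \<bullet> t)))
        + complex_of_real (- 2 * pi * ((t - ?x) \<bullet> (t - ?x))))"
      by (simp only: complex_cnj_mult cis_cnj complex_cnj_complex_of_real)
        (simp only: cis_conv_exp exp_of_real[symmetric] exp_add, simp)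
    also have "\<i> * complex_of_real (pi * (?w \<bullet> ?x)) + - (\<i> * complex_of_real (2 * pi * (?w \<bullet> t)))
        + complex_of_real (- 2 * pi * ((t - ?x) \<bullet> (t - ?x)))
      = (\<i> * complex_of_real (pi * (?w \<bullet> ?x)) - complex_of_real (2 * pi * (?x \<bullet> ?x))) + complex_of_real (- 2 * pi * (t \<bullet> t))
        + cdot (complex_of_real (4 * pi) *s cvec ?x - (2 * pi * \<i>) *s cvec ?w) t"
      by (simp add: cdot_diff cdot_smult cdot_cvec inner_diff_left inner_diff_right inner_commute[of t ?x] algebra_simps)
    finally show "rep_L2 f t * cnj (?g t) = exp (\<i> * complex_of_real (pi * (?w \<bullet> ?x)) - complex_of_real (2 * pi * (?x \<bullet> ?x))) *
      ((rep_L2 f t * complex_of_real (exp (- 2 * pi * (t \<bullet> t)))) *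
       exp (cdot (complex_of_real (4 * pi) *s cvec ?x - (2 * pi * \<i>) *s cvec ?w) t))"
      by (simp only: exp_add exp_of_real mult_ac)
  qed
  also have "\<dots> = exp (\<i> * complex_of_real (pi * (?w \<bullet> ?x)) - complex_of_real (2 * pi * (?x \<bullet> ?x))) *
    laplace (\<lambda>t. rep_L2 f t * complex_of_real (exp (- 2 * pi * (t \<bullet> t))))
      (complex_of_real (4 * pi) *s cvec ?x - (2 * pi * \<i>) *s cvec ?w)"
    unfolding laplace_def by (rule integral_mult_right_zero)
  finally show ?thesis .
qed

text \<open>Without a translation the product inside the integral stays fixed and inherits the
  support of \<open>f\<close>; this is what later bounds the exponential type.\<close>

lemma cinner_modulation:
  fixes f g :: "(real ^ 'n::finite) L2"
  assumes "pos \<eta> = 0"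
  shows "cinner f (\<rho> \<eta> g) = laplace (\<lambda>t. rep_L2 f t * cnj (rep_L2 g t)) ((- 2 * pi * \<i>) *s cvec (freq \<eta>))"
proof -
  have "cinner f (\<rho> \<eta> g) = (LINT t|lborel. rep_L2 f t *
      cnj (cis (- pi * (freq \<eta> \<bullet> pos \<eta>)) * cis (2 * pi * (freq \<eta> \<bullet> t)) * rep_L2 g (t - pos \<eta>)))"
    unfolding time_freq_shift_rep
    by (rule cinner_abs_L2_right[OF square_integrable_time_freq_shift[OF square_integrable_rep_L2]])
  also have "\<dots> = laplace (\<lambda>t. rep_L2 f t * cnj (rep_L2 g t)) ((- 2 * pi * \<i>) *s cvec (freq \<eta>))"
    unfolding laplace_def cdot_smult cdot_cvec
    by (intro Bochner_Integration.integral_cong refl) (simp add: assms cis_cnj, simp add: cis_conv_exp mult_ac)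
  finally show ?thesis .
qed

section \<open>Linear symplectic geometry of phase space\<close>

definition phase_point :: "real ^ 'n \<Rightarrow> real ^ 'n \<Rightarrow> real ^ ('n::finite + 'n)" where
  "phase_point x w = (\<chi> i. case i of Inl a \<Rightarrow> x $ a | Inr a \<Rightarrow> w $ a)"

lemma pos_phase_point [simp]: "pos (phase_point x w) = x"
  and freq_phase_point [simp]: "freq (phase_point x w) = w"
  by (simp_all add: phase_point_def pos_def freq_def vec_eq_iff)

lemma phase_point_eqI: "pos z = pos z' \<Longrightarrow> freq z = freq z' \<Longrightarrow> z = z'"
  by (simp add: vec_eq_iff pos_def freq_def) (metis sumE)

lemma sum_UNIV_Plus:
  fixes f :: "'a::finite + 'b::finite \<Rightarrow> 'c::comm_monoid_add"
  shows "(\<Sum>i\<in>UNIV. f i) = (\<Sum>a\<in>UNIV. f (Inl a)) + (\<Sum>b\<in>UNIV. f (Inr b))"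
  unfolding UNIV_Plus_UNIV[symmetric] by (subst sum.Plus) auto

lemma inner_phase_space: "u \<bullet> v = pos u \<bullet> pos v + freq u \<bullet> freq v"
  by (simp add: inner_vec_def sum_UNIV_Plus pos_def freq_def)

lemma pos_J_mat: "pos (J_mat *v v) = freq v"
  and freq_J_mat: "freq (J_mat *v v) = - pos v"
  by (simp_all add: vec_eq_iff pos_def freq_def J_mat_def block_mat_def matrix_vector_mult_def
      sum_UNIV_Plus mat_def if_distrib[of "\<lambda>c. c * x" for x] sum_negf cong: if_cong)

lemma symplectic_form:
  assumes "symplectic M"
  shows "pos (M *v u) \<bullet> freq (M *v v) - freq (M *v u) \<bullet> pos (M *v v) = pos u \<bullet> freq v - freq u \<bullet> pos v"
proof -
  have form: "a \<bullet> (J_mat *v b) = pos a \<bullet> freq b - freq a \<bullet> pos b" for a b :: "real ^ ('a + 'a)"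
    by (simp add: inner_phase_space pos_J_mat freq_J_mat)
  have "u \<bullet> (J_mat *v v) = u \<bullet> (transpose M *v (J_mat *v (M *v v)))"
    using assms by (simp add: symplectic_def matrix_vector_mul_assoc matrix_mul_assoc)
  also have "\<dots> = (M *v u) \<bullet> (J_mat *v (M *v v))"
    by (metis dot_lmul_matrix transpose_matrix_vector transpose_transpose inner_commute)
  finally show ?thesis by (simp add: form)
qed

lemma symplectic_right_inverse:
  fixes M :: "real ^ ('n::finite + 'n) ^ ('n + 'n)"
  assumes "symplectic M"
  obtains M' where "M ** M' = mat 1"
proof -
  have "x = 0" if "M *v x = 0" for x
  proof (rule phase_point_eqI)
    have "transpose M ** J_mat ** M *v x = 0"
      using that by (simp flip: matrix_vector_mul_assoc)
    then have J: "J_mat *v x = 0" using assms by (simp add: symplectic_def)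
    have "pos 0 = (0 :: real ^ 'n)" "freq 0 = (0 :: real ^ 'n)"
      by (simp_all add: pos_def freq_def vec_eq_iff)
    then show "pos x = pos 0" "freq x = freq 0"
      using pos_J_mat[of x] freq_J_mat[of x] J by simp_all
  qed
  then obtain M' where "M' ** M = mat 1"
    using matrix_left_invertible_ker[of M] by blast
  then show ?thesis
    using that matrix_left_right_inverse[of M' M] by simp
qed

lemma entire_on_lines_diff:
  "entire_on_lines f \<Longrightarrow> entire_on_lines g \<Longrightarrow> entire_on_lines (\<lambda>z. f z - g z)"
  and entire_on_lines_mult:
  "entire_on_lines f \<Longrightarrow> entire_on_lines g \<Longrightarrow> entire_on_lines (\<lambda>z. f z * g z)"
  by (simp_all add: entire_on_lines_def holomorphic_on_diff holomorphic_on_mult)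

lemma cvec_decompose: "cvec (\<chi> i. Re (z $ i)) + \<i> *s cvec (\<chi> i. Im (z $ i)) = z"
  by (simp add: vec_eq_iff complex_eq_iff)

lemma matrix_vector_smult: "A *v (c *s x) = c *s (A *v x)" for A :: "complex ^ 'n::finite ^ 'm::finite"
  by (simp add: vec_eq_iff matrix_vector_mult_def sum_distrib_left mult_ac)

definition cmat :: "real ^ 'n ^ 'm \<Rightarrow> complex ^ 'n ^ 'm" where
  "cmat A = (\<chi> i j. complex_of_real (A $ i $ j))"

lemma cmat_mult_cvec: "cmat A *v cvec x = cvec (A *v x)"
  by (simp add: vec_eq_iff cmat_def matrix_vector_mult_def)

text \<open>The step length must be found before \<open>f\<close> is given, so that one lattice
  serves all functions whose transform lives in the ball; it is built from the inverse of
  \<open>M\<close> and from \<open>R\<close> alone.\<close>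

lemma coherent_state_sampling:
  fixes M :: "real ^ ('n::finite + 'n) ^ ('n + 'n)" and U :: "(real ^ 'n) L2 \<Rightarrow> (real ^ 'n) L2"
  assumes M: "symplectic M" and U: "is_metaplectic M U"
  shows "\<exists>\<epsilon>>0. \<forall>f. (AE t in lborel. norm t > R \<longrightarrow> rep_L2 (U f) t = 0) \<longrightarrow>
    (\<forall>k. (\<forall>i. k $ i \<in> \<int>) \<longrightarrow> cinner f (\<rho> (phase_point (\<epsilon> *\<^sub>R k) 0) symbol_gaussian) = 0) \<longrightarrow> f = 0"
proof -
  obtain M' where M': "M ** M' = mat 1"
    using symplectic_right_inverse[OF M] .
  then have MM': "M *v (M' *v y) = y" for y
    by (simp add: matrix_vector_mul_assoc)
  \<comment> \<open>The blocks of the inverse that act on pure frequencies: \<open>M\<close> carries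
    the point \<open>(P w, Q w)\<close> to a pure modulation.\<close>
  define P :: "real ^ 'n ^ 'n" where "P = (\<chi> i j. M' $ Inl i $ Inr j)"
  define Q :: "real ^ 'n ^ 'n" where "Q = (\<chi> i j. M' $ Inr i $ Inr j)"
  have pos_M': "pos (M' *v phase_point 0 w) = P *v w" and freq_M': "freq (M' *v phase_point 0 w) = Q *v w" for w
    by (simp_all add: vec_eq_iff P_def Q_def pos_def freq_def matrix_vector_mult_def sum_UNIV_Plus phase_point_def)
  \<comment> \<open>The argument of the Laplace transform in \<open>cinner_coherent_state\<close> at
    the point \<open>(P w, Q w)\<close>, extended to complex \<open>w\<close>.\<close>
  define N where "N = (\<chi> i j. complex_of_real (4 * pi) * cmat P $ i $ j - (2 * pi * \<i>) * cmat Q $ i $ j)"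
  have N: "N *v z = complex_of_real (4 * pi) *s (cmat P *v z) - (2 * pi * \<i>) *s (cmat Q *v z)" for z
    by (simp add: N_def vec_eq_iff matrix_vector_mult_def sum_distrib_left left_diff_distrib right_diff_distrib sum_subtractf mult_ac)
  \<comment> \<open>For \<open>z = a + i b\<close> in the kernel, \<open>Q b = - 2 P a\<close> and
    \<open>Q a = 2 P b\<close>. The symplectic form vanishes on pure frequencies, hence on their
    images, and this forces the squared norms of \<open>P a\<close> and \<open>P b\<close> to sum to
    0. Then \<open>Q a\<close> and \<open>Q b\<close> vanish too, and injectivity of the inverse
    matrix finishes.\<close>
  have "z = 0" if z: "N *v z = 0" for z
  proof -
    let ?a = "\<chi> i. Re (z $ i)" and ?b = "\<chi> i. Im (z $ i)"
    have A: "cmat A *v z = cvec (A *v ?a) + \<i> *s cvec (A *v ?b)" for A :: "real ^ 'n ^ 'n"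
      by (subst cvec_decompose[of z, symmetric]) (simp only: matrix_vector_right_distrib matrix_vector_smult cmat_mult_cvec)
    have "2 * pi * (2 * (P *v ?a) $ i + (Q *v ?b) $ i) = 0" "2 * pi * (2 * (P *v ?b) $ i - (Q *v ?a) $ i) = 0" for i
      using arg_cong[OF z, of "\<lambda>v. v $ i"] unfolding N A by (simp_all add: complex_eq_iff algebra_simps)
    then have "(Q *v ?b) $ i = - 2 * (P *v ?a) $ i" "(Q *v ?a) $ i = 2 * (P *v ?b) $ i" for i
      by (simp_all add: add_eq_0_iff)
    then have QP: "Q *v ?b = (- 2) *\<^sub>R (P *v ?a)" "Q *v ?a = 2 *\<^sub>R (P *v ?b)"
      by (simp_all add: vec_eq_iff)
    have "(P *v ?a) \<bullet> (Q *v ?b) - (Q *v ?a) \<bullet> (P *v ?b) = 0"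
      using symplectic_form[OF M, of "M' *v phase_point 0 ?a" "M' *v phase_point 0 ?b"]
      by (simp add: MM' pos_M' freq_M')
    then have "(P *v ?a) \<bullet> (P *v ?a) + (P *v ?b) \<bullet> (P *v ?b) = 0"
      unfolding QP by simp
    then have P0: "P *v ?a = 0" "P *v ?b = 0"
      by (simp_all add: add_nonneg_eq_0_iff)
    have inj: "w = 0" if "P *v w = 0" "Q *v w = 0" for w
    proof -
      have "M' *v phase_point 0 w = 0"
        by (rule phase_point_eqI) (use that in \<open>simp_all add: pos_M' freq_M', simp_all add: pos_def freq_def vec_eq_iff\<close>)
      then have "phase_point 0 w = 0" using MM'[of "phase_point 0 w"] by simp
      then have "freq (phase_point 0 w) = freq 0" by simp
      then show "w = 0" by (simp add: freq_def vec_eq_iff del: freq_phase_point) (simp add: phase_point_def)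
    qed
    have "?a = 0" "?b = 0"
      by (rule inj; simp add: P0 QP)+
    then show "z = 0"
      using cvec_decompose[of z] by (simp add: vec_eq_iff)
  qed
  then obtain N' where "N' ** N = mat 1"
    using matrix_left_invertible_ker[of N] by blast
  then have "N ** N' = mat 1" using matrix_left_right_inverse[of N' N] by simp
  then have NN': "N *v (N' *v z) = z" for z
    by (simp add: matrix_vector_mul_assoc)
  \<comment> \<open>Solving \<open>N \<zeta> = 4 \<pi> s\<close> for \<open>\<zeta>\<close> matches
    the point \<open>G s\<close> on the side of \<open>U f\<close> with the point
    \<open>4 \<pi> s\<close> on the side of \<open>f\<close>; for real \<open>s\<close> the latter
    belongs to the sample at position \<open>s\<close>.\<close>
  define G where "G s = (- 2 * pi * \<i>) *s (N' *v (complex_of_real (4 * pi) *s s))" for s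
  have G_add: "G (u + v) = G u + G v" and G_smult: "G (c *s u) = c *s G u" for u v c
    by (simp_all add: G_def matrix_vector_right_distrib matrix_vector_smult vec_eq_iff algebra_simps)
  have cR: "r *\<^sub>R z = complex_of_real r *s z" for r and z :: "complex ^ 'n"
    unfolding vec_eq_iff vector_scaleR_component vector_smult_component by (simp add: scaleR_conv_of_real)
  have "linear G"
    by (rule linearI) (simp_all only: G_add cR G_smult)
  then obtain \<kappa> where \<kappa>: "\<kappa> > 0" "\<And>s. norm (G s) \<le> \<kappa> * norm s"
    using linear_bounded_pos by blast
  \<comment> \<open>Scaling by \<open>\<epsilon>\<close> brings the exponential type down to the
    \<open>1/10\<close> of \<open>carlson_lattice\<close>; the summand 1 keeps the denominator
    positive when \<open>R\<close> is 0.\<close>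
  define \<epsilon> where "\<epsilon> = 1 / (10 * (real CARD('n) * \<bar>R\<bar> * \<kappa> + 1))"
  have pos: "real CARD('n) * \<bar>R\<bar> * \<kappa> + 1 > 0"
    using \<kappa>(1) by (intro add_nonneg_pos) auto
  then have \<epsilon>: "\<epsilon> > 0" by (simp add: \<epsilon>_def)
  have \<epsilon>10: "real CARD('n) * \<bar>R\<bar> * \<kappa> * \<epsilon> \<le> 1 / 10"
    using pos by (simp add: \<epsilon>_def field_simps)
  show ?thesis
  proof (intro exI[of _ \<epsilon>] conjI allI impI)
    show "\<epsilon> > 0" by (rule \<epsilon>)
    fix f
    assume supp: "AE t in lborel. norm t > R \<longrightarrow> rep_L2 (U f) t = 0"
      and zero: "\<forall>k. (\<forall>i. k $ i \<in> \<int>) \<longrightarrow> cinner f (\<rho> (phase_point (\<epsilon> *\<^sub>R k) 0) symbol_gaussian) = 0"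
    define h where "h t = rep_L2 f t * complex_of_real (exp (- 2 * pi * (t \<bullet> t)))" for t
    define H where "H t = rep_L2 (U f) t * cnj (rep_L2 (U symbol_gaussian) t)" for t
    have h: "exp_moments h" unfolding h_def by (rule exp_moments_gaussian)
    have H_int: "integrable lborel H"
      unfolding H_def by (intro square_integrable_mult_integrable square_integrable_rep_L2)
    have H_supp: "AE t in lborel. norm t > R \<longrightarrow> H t = 0"
      using supp by eventually_elim (auto simp: H_def)
    have H: "exp_moments H" by (rule exp_moments_bounded_support[OF H_int H_supp])
    \<comment> \<open>The exponent of \<open>cinner_coherent_state\<close> at
      \<open>(P w, Q w)\<close>, written with bilinear sums so that it extends holomorphically to
      complex vectors.\<close>
    define q where "q z = \<i> * pi * (\<Sum>i\<in>UNIV. (cmat Q *v z) $ i * (cmat P *v z) $ i)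
        - 2 * pi * (\<Sum>i\<in>UNIV. (cmat P *v z) $ i * (cmat P *v z) $ i)" for z
    \<comment> \<open>Intertwining and unitarity turn a modulation on the side of \<open>U f\<close>
      into a coherent state on the side of \<open>f\<close>; each side is then a Laplace
      transform.\<close>
    have real: "laplace H ((- 2 * pi * \<i>) *s cvec w) = exp (q (cvec w)) * laplace h (N *v cvec w)" for w
    proof -
      let ?\<xi> = "M' *v phase_point 0 w"
      have "laplace H ((- 2 * pi * \<i>) *s cvec w) = cinner (U f) (\<rho> (phase_point 0 w) (U symbol_gaussian))"
        by (simp add: cinner_modulation H_def[abs_def])
      also have "\<dots> = cinner (U f) (U (\<rho> ?\<xi> symbol_gaussian))"
        by (simp only: metaplectic_intertwines[OF U] MM')
      also have "\<dots> = cinner f (\<rho> ?\<xi> symbol_gaussian)"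
        using U by (simp add: is_metaplectic_def unitary_op_def)
      also have "\<dots> = exp (\<i> * complex_of_real (pi * ((Q *v w) \<bullet> (P *v w))) - complex_of_real (2 * pi * ((P *v w) \<bullet> (P *v w))))
          * laplace h (N *v cvec w)"
        unfolding cinner_coherent_state pos_M' freq_M' N cmat_mult_cvec h_def ..
      also have "\<i> * complex_of_real (pi * ((Q *v w) \<bullet> (P *v w))) - complex_of_real (2 * pi * ((P *v w) \<bullet> (P *v w))) = q (cvec w)"
        by (simp add: q_def cmat_mult_cvec inner_vec_def)
      finally show ?thesis .
    qed
    \<comment> \<open>Both sides are entire on lines and agree at real vectors, so they agree
      everywhere.\<close>
    have ext: "laplace H ((- 2 * pi * \<i>) *s z) = exp (q z) * laplace h (N *v z)" for z
    proof -
      let ?D = "\<lambda>z. laplace H ((- 2 * pi * \<i>) *s z) - exp (q z) * laplace h (N *v z)"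
      have "entire_on_lines (\<lambda>z. laplace H ((- 2 * pi * \<i>) *s z))"
        by (rule entire_on_lines_compose[OF entire_on_lines_laplace[OF H]]) (simp add: vec_eq_iff algebra_simps)
      moreover have "entire_on_lines (\<lambda>z. laplace h (N *v z))"
        by (rule entire_on_lines_compose[OF entire_on_lines_laplace[OF h]])
          (simp add: matrix_vector_right_distrib matrix_vector_smult)
      moreover have "entire_on_lines (\<lambda>z. exp (q z))"
        unfolding entire_on_lines_def q_def matrix_vector_right_distrib matrix_vector_smult
          vector_add_component vector_smult_component
        by (intro allI holomorphic_intros)
      ultimately have "entire_on_lines ?D"
        by (intro entire_on_lines_diff entire_on_lines_mult)
      then have "?D z = 0"
        by (rule entire_on_lines_eq_0) (simp only: real diff_self)
      then show ?thesis by simp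
    qed
    have ext': "laplace H (G s) = exp (q (N' *v (complex_of_real (4 * pi) *s s))) * laplace h (complex_of_real (4 * pi) *s s)" for s
      unfolding G_def ext NN' ..
    \<comment> \<open>Rescaled so that the sampling points correspond to integer vectors: there
      \<open>ext'\<close> makes \<open>\<Psi>\<close> a multiple of a vanishing sample.\<close>
    define \<Psi> where "\<Psi> s = laplace H (G (complex_of_real \<epsilon> *s s))" for s
    have \<Psi>: "\<Psi> s = 0" for s
    proof (rule carlson_lattice)
      show "entire_on_lines \<Psi>"
        unfolding \<Psi>_def
        by (rule entire_on_lines_compose[OF entire_on_lines_laplace[OF H]])
          (simp add: G_add G_smult vec_eq_iff algebra_simps)
      fix s :: "complex ^ 'n"
      let ?C = "LINT t|lborel. cmod (H t)"
      have "norm (G (complex_of_real \<epsilon> *s s)) \<le> \<kappa> * (\<epsilon> * norm s)"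
        using \<kappa>(2)[of "complex_of_real \<epsilon> *s s"] \<epsilon> by (simp flip: cR)
      then have "real CARD('n) * \<bar>R\<bar> * norm (G (complex_of_real \<epsilon> *s s)) \<le> real CARD('n) * \<bar>R\<bar> * (\<kappa> * (\<epsilon> * norm s))"
        by (intro mult_left_mono) auto
      also have "\<dots> = real CARD('n) * \<bar>R\<bar> * \<kappa> * \<epsilon> * norm s" by simp
      also have "\<dots> \<le> 1 / 10 * norm s" by (intro mult_right_mono \<epsilon>10) auto
      finally have "?C * exp (real CARD('n) * \<bar>R\<bar> * norm (G (complex_of_real \<epsilon> *s s))) \<le> ?C * exp (norm s / 10)"
        by (intro mult_left_mono) auto
      then show "cmod (\<Psi> s) \<le> ?C * exp (norm s / 10)"
        unfolding \<Psi>_def using norm_laplace_le[OF H_int H_supp] order_trans by blast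
    next
      fix s :: "complex ^ 'n"
      assume s: "\<And>i. s $ i \<in> \<int>"
      define k where "k = (\<chi> i. Re (s $ i))"
      have k: "k $ i \<in> \<int>" and sk: "s $ i = complex_of_real (k $ i)" for i
        using s[of i] by (auto simp: k_def elim: Ints_cases)
      have "complex_of_real \<epsilon> *s s = cvec (\<epsilon> *\<^sub>R k)"
        by (simp add: vec_eq_iff sk)
      moreover have "cvec 0 = (0 :: complex ^ 'n)" by (simp add: vec_eq_iff)
      ultimately have "laplace h (complex_of_real (4 * pi) *s (complex_of_real \<epsilon> *s s)) = 0"
        using zero[rule_format, OF k] unfolding cinner_coherent_state h_def by simp
      then show "\<Psi> s = 0" unfolding \<Psi>_def ext' by simp
    qed
    \<comment> \<open>The exponential factor in \<open>ext'\<close> has no zeros and the rescaling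
      is onto, so the vanishing of \<open>\<Psi>\<close> passes to all of
      \<open>laplace h\<close>.\<close>
    have "laplace h z = 0" for z
    proof -
      have "complex_of_real (4 * pi) *s (complex_of_real \<epsilon> *s (complex_of_real (1 / (4 * pi * \<epsilon>)) *s z)) = z"
        using \<epsilon> by (simp add: vec_eq_iff)
      then show ?thesis
        using \<Psi>[of "complex_of_real (1 / (4 * pi * \<epsilon>)) *s z"] unfolding \<Psi>_def ext' by simp
    qed
    \<comment> \<open>Purely imaginary arguments turn the Laplace transform back into a Fourier
      transform.\<close>
    then have "(LINT t|lborel. h t * cis (w \<bullet> t)) = 0" for w
      using laplace_def[of h "\<i> *s cvec w"] by (simp add: cdot_smult cdot_cvec cis_conv_exp)
    moreover have "integrable lborel h"
    proof -
      have "integrable lborel (\<lambda>t. cmod (h t) * exp (0 * norm t))" and [measurable]: "h \<in> borel_measurable borel"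
        using h unfolding exp_moments_def by blast+
      then show ?thesis by (simp add: integrable_norm_iff)
    qed
    ultimately have "AE t in lborel. h t = 0"
      by (intro fourier_transform_eq_0_imp_AE_eq_0)
    then show "f = 0"
      unfolding L2_eq_0_iff by eventually_elim (simp add: h_def)
  qed
qed

section \<open>The Weyl symbol of a shifted Gaussian window\<close>

text \<open>Lets an almost-everywhere formula for a representative be used at the points
  \<open>pos v + t / 2\<close> and \<open>pos v - t / 2\<close> of the Wigner integral.\<close>

lemma AE_lborel_affine:
  fixes a :: "'a::euclidean_space"
  assumes c: "c \<noteq> 0" and P: "AE x in lborel. P x"
  shows "AE x in lborel. P (a + c *\<^sub>R x)"
proof -
  obtain N where N: "{x. \<not> P x} \<subseteq> N" "N \<in> null_sets lborel"
    using P by (auto simp: eventually_ae_filter)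
  then have "AE x in density (distr lborel borel (\<lambda>x. a + c *\<^sub>R x)) (\<lambda>_. \<bar>c\<bar> ^ DIM('a)). x \<notin> N"
    by (simp add: lborel_affine[OF c, symmetric] AE_not_in)
  then have "AE x in distr lborel borel (\<lambda>x. a + c *\<^sub>R x). x \<notin> N"
    using c by (subst (asm) AE_density) auto
  moreover have "{x. x \<notin> N} \<in> sets borel"
    using N by (auto simp: Compl_eq[symmetric])
  ultimately have "AE x in lborel. a + c *\<^sub>R x \<notin> N"
    by (subst (asm) AE_distr_iff) auto
  then show ?thesis
    using N(1) by (auto elim!: eventually_mono)
qed

text \<open>By the parallelogram law the two Gaussian factors split into a Gaussian in the position
  difference and one in \<open>t\<close>; the phases leave a linear one, and the remaining integral
  is the Fourier transform of a Gaussian at the frequency difference. The constant is the same for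
  every \<open>z\<close>.\<close>

lemma wigner_coherent_state:
  "\<exists>c. c \<noteq> 0 \<and> (\<forall>z :: real ^ ('n::finite + 'n).
     wigner (\<rho> z gaussian) (\<rho> z gaussian) = c *\<^sub>C \<rho> (phase_point z 0) symbol_gaussian)"
proof (intro exI conjI allI)
  define \<gamma> :: real where "\<gamma> = 2 powr (real CARD('n) / 4)"
  \<comment> \<open>Two normalisations \<open>\<gamma>\<close> of the Gaussian and the factor from
    \<open>fourier_gaussian\<close>; together they give \<open>2 ^ CARD('n)\<close>.\<close>
  define c where "c = complex_of_real (\<gamma>\<^sup>2 * sqrt 2 ^ CARD('n))"
  show "c \<noteq> 0" by (simp add: c_def \<gamma>_def)
  fix z :: "real ^ ('n + 'n)"
  let ?x = "pos z" and ?w = "freq z"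
  define a where "a = rep_L2 (\<rho> z (gaussian :: (real ^ 'n) L2))"
  have [measurable]: "a \<in> borel_measurable borel"
    unfolding a_def by measurable
  have gauss: "gaussian = abs_L2 (\<lambda>t::real ^ 'n. complex_of_real (\<gamma> * exp (- pi * (t \<bullet> t))))"
    by (simp add: gaussian_def \<gamma>_def)
  have sq: "square_integrable (\<lambda>t::real ^ 'n. complex_of_real (\<gamma> * exp (- pi * (t \<bullet> t))))"
    by (rule square_integrable_gaussian)
  have a: "AE t in lborel. a t = cis (- pi * (?w \<bullet> ?x)) * cis (2 * pi * (?w \<bullet> t)) * complex_of_real (\<gamma> * exp (- pi * ((t - ?x) \<bullet> (t - ?x))))"
    unfolding a_def gauss time_freq_shift_abs_L2[OF sq]
    by (rule rep_abs_L2[OF square_integrable_time_freq_shift[OF sq]])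
  have "(LINT t|lborel. a (pos v + t /\<^sub>R 2) * cnj (a (pos v - t /\<^sub>R 2)) * cis (- 2 * pi * (t \<bullet> freq v)))
      = c * complex_of_real (exp (- 2 * pi * ((v - z) \<bullet> (v - z))))" for v
  proof -
    let ?b = "pos v - ?x" and ?s = "freq v - ?w"
    \<comment> \<open>The case \<open>r = 0\<close> is excluded because a constant map does not
      respect null sets; the values used are \<open>1/2\<close> and \<open>- 1/2\<close>.\<close>
    have affine: "AE t in lborel. r \<noteq> 0 \<longrightarrow> a (pos v + r *\<^sub>R t) = cis (- pi * (?w \<bullet> ?x)) * cis (2 * pi * (?w \<bullet> (pos v + r *\<^sub>R t))) *
        complex_of_real (\<gamma> * exp (- pi * ((pos v + r *\<^sub>R t - ?x) \<bullet> (pos v + r *\<^sub>R t - ?x))))" for r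
      using AE_lborel_affine[OF _ a, of r "pos v"] by (cases "r = 0") auto
    have "AE t in lborel. a (pos v + t /\<^sub>R 2) * cnj (a (pos v - t /\<^sub>R 2)) * cis (- 2 * pi * (t \<bullet> freq v)) =
        complex_of_real (\<gamma>\<^sup>2 * exp (- 2 * pi * (?b \<bullet> ?b))) * (complex_of_real (exp (- pi * (t \<bullet> t) / 2)) * cis (- 2 * pi * (t \<bullet> ?s)))"
      using affine[of "1/2"] affine[of "- 1/2"]
    proof eventually_elim
      case (elim t)
      have half: "(1/2 :: real) \<noteq> 0" "(- 1/2 :: real) \<noteq> 0" by simp_all
      have e: "pos v + t /\<^sub>R 2 = pos v + (1/2) *\<^sub>R t" "pos v - t /\<^sub>R 2 = pos v + (- 1/2) *\<^sub>R t"
        by simp_all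
      have phase: "cis p * cis q1 * complex_of_real r1 * cnj (cis p * cis q2 * complex_of_real r2) * cis q3
          = complex_of_real (r1 * r2) * cis (q1 - q2 + q3)" for p q1 q2 q3 r1 r2
      proof -
        have "cis p * cis q1 * complex_of_real r1 * cnj (cis p * cis q2 * complex_of_real r2) * cis q3
          = complex_of_real (r1 * r2) * cis (p + q1 + (- p + - q2) + q3)"
          by (simp only: cis_mult[symmetric] cis_cnj[symmetric] complex_cnj_mult complex_cnj_complex_of_real of_real_mult mult_ac)
        then show ?thesis by simp
      qed
      have ph: "2 * pi * (?w \<bullet> (pos v + (1/2) *\<^sub>R t)) - 2 * pi * (?w \<bullet> (pos v + (- 1/2) *\<^sub>R t)) + - 2 * pi * (t \<bullet> freq v)
          = - 2 * pi * (t \<bullet> ?s)"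
        by (simp add: inner_add_right inner_diff_right inner_commute[of ?w t] algebra_simps)
      have am: "\<gamma> * exp (- pi * ((pos v + (1/2) *\<^sub>R t - ?x) \<bullet> (pos v + (1/2) *\<^sub>R t - ?x))) *
          (\<gamma> * exp (- pi * ((pos v + (- 1/2) *\<^sub>R t - ?x) \<bullet> (pos v + (- 1/2) *\<^sub>R t - ?x))))
          = \<gamma>\<^sup>2 * exp (- 2 * pi * (?b \<bullet> ?b)) * exp (- pi * (t \<bullet> t) / 2)"
      proof -
        have d: "pos v + (1/2) *\<^sub>R t - ?x = ?b + (1/2) *\<^sub>R t" "pos v + (- 1/2) *\<^sub>R t - ?x = ?b - (1/2) *\<^sub>R t"
          by simp_all
        have parallelogram: "(b + u) \<bullet> (b + u) + (b - u) \<bullet> (b - u) = 2 * (b \<bullet> b) + 2 * (u \<bullet> u)" for b u :: "real ^ 'n"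
          by (simp add: inner_add_left inner_add_right inner_diff_left inner_diff_right)
        have "- pi * ((?b + (1/2) *\<^sub>R t) \<bullet> (?b + (1/2) *\<^sub>R t)) + - pi * ((?b - (1/2) *\<^sub>R t) \<bullet> (?b - (1/2) *\<^sub>R t))
           = - 2 * pi * (?b \<bullet> ?b) + - pi * (t \<bullet> t) / 2"
          unfolding distrib_left[symmetric] parallelogram by (simp add: distrib_left)
        moreover have "\<gamma> * exp p * (\<gamma> * exp q) = \<gamma>\<^sup>2 * exp (p + q)" "\<gamma>\<^sup>2 * exp p * exp q = \<gamma>\<^sup>2 * exp (p + q)" for p q
          by (simp_all add: exp_add power2_eq_square)
        ultimately show ?thesis
          unfolding d by (simp only:)
      qed
      show ?case
        unfolding e elim(1)[rule_format, OF half(1)] elim(2)[rule_format, OF half(2)] phase ph am by simp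
    qed
    then have "(LINT t|lborel. a (pos v + t /\<^sub>R 2) * cnj (a (pos v - t /\<^sub>R 2)) * cis (- 2 * pi * (t \<bullet> freq v)))
      = (LINT t|lborel. complex_of_real (\<gamma>\<^sup>2 * exp (- 2 * pi * (?b \<bullet> ?b))) *
          (complex_of_real (exp (- pi * (t \<bullet> t) / 2)) * cis (- 2 * pi * (t \<bullet> ?s))))"
      unfolding cis_conv_exp by (intro integral_cong_AE) measurable
    also have "\<dots> = complex_of_real (\<gamma>\<^sup>2 * exp (- 2 * pi * (?b \<bullet> ?b))) * complex_of_real (sqrt 2 ^ DIM(real ^ 'n) * exp (- 2 * pi * (?s \<bullet> ?s)))"
      by (simp only: integral_mult_right_zero fourier_gaussian)
    also have "\<dots> = c * complex_of_real (exp (- 2 * pi * (?b \<bullet> ?b)) * exp (- 2 * pi * (?s \<bullet> ?s)))"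
      by (simp add: c_def)
    also have "exp (- 2 * pi * (?b \<bullet> ?b)) * exp (- 2 * pi * (?s \<bullet> ?s)) = exp (- 2 * pi * ((v - z) \<bullet> (v - z)))"
    proof -
      have "pos (v - z) = ?b" "freq (v - z) = ?s" by (simp_all add: pos_def freq_def vec_eq_iff)
      then have "- 2 * pi * ((v - z) \<bullet> (v - z)) = - 2 * pi * (?b \<bullet> ?b) + - 2 * pi * (?s \<bullet> ?s)"
        unfolding inner_phase_space by (simp only: distrib_left)
      then show ?thesis by (simp only: exp_add)
    qed
    finally show ?thesis .
  qed
  then have w: "wigner (\<rho> z gaussian) (\<rho> z gaussian) = abs_L2 (\<lambda>v. c * complex_of_real (exp (- 2 * pi * ((v - z) \<bullet> (v - z)))))"
    unfolding wigner_def a_def[symmetric] by (simp only:)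
  have "\<rho> (phase_point z 0) symbol_gaussian = abs_L2 (\<lambda>v. complex_of_real (exp (- 2 * pi * ((v - z) \<bullet> (v - z)))))"
    unfolding symbol_gaussian_def time_freq_shift_abs_L2[OF square_integrable_symbol_gaussian] by simp
  then show "wigner (\<rho> z gaussian) (\<rho> z gaussian) = c *\<^sub>C \<rho> (phase_point z 0) symbol_gaussian"
    using scaleC.abs_eq[of "\<lambda>v. complex_of_real (exp (- 2 * pi * ((v - z) \<bullet> (v - z))))" c]
      square_integrable_translate[OF square_integrable_symbol_gaussian, of z] w
    by (simp only: L2rel_self_iff)
qed

section \<open>Identifiability on a scaled integer lattice\<close>

theorem theorem1p4:
  fixes \<A> :: "real ^ (('d::finite + 'd) + ('d + 'd)) ^ (('d + 'd) + ('d + 'd))"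
    and L A A' B' :: "real ^ ('d + 'd) ^ ('d + 'd)"
    and \<mu>\<A> :: "(real ^ ('d + 'd)) L2 \<Rightarrow> (real ^ ('d + 'd)) L2"
    and K :: "(real ^ ('d + 'd)) set"
  assumes "symplectic \<A>"
    and "invertible L"
    and "transpose A = A" and "transpose A' = A'" and "transpose B' = B'"
    and "\<A> = D_mat L ** V_mat A' ** transpose (V_mat B') ** V_mat A"
    and "simultaneously_diagonalisable A B'"
    and "is_metaplectic \<A> \<mu>\<A>"
    and "compact K"
  shows "\<exists>\<Lambda> :: (real ^ ('d + 'd)) set. is_lattice \<Lambda> \<and>
    identifiable \<Lambda> (gaussian_window :: (real ^ 'd) L2 \<Rightarrow> (real ^ 'd) L2) (symbol_supported \<mu>\<A> K)"
proof -
  obtain R where R: "K \<subseteq> cball 0 R"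
    using compact_imp_bounded[OF \<open>compact K\<close>] by (auto simp: bounded_iff subset_iff)
  obtain \<epsilon> where \<epsilon>: "\<epsilon> > 0"
    and sampling: "\<forall>f. (AE t in lborel. norm t > R \<longrightarrow> rep_L2 (\<mu>\<A> f) t = 0) \<longrightarrow>
      (\<forall>k. (\<forall>i. k $ i \<in> \<int>) \<longrightarrow> cinner f (\<rho> (phase_point (\<epsilon> *\<^sub>R k) 0) symbol_gaussian) = 0) \<longrightarrow> f = 0"
    using coherent_state_sampling[OF \<open>symplectic \<A>\<close> \<open>is_metaplectic \<A> \<mu>\<A>\<close>, of R] by blast
  obtain c where c: "c \<noteq> 0" and wigner: "\<forall>z :: real ^ ('d + 'd).
      wigner (\<rho> z gaussian) (\<rho> z gaussian) = c *\<^sub>C \<rho> (phase_point z 0) symbol_gaussian"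
    using wigner_coherent_state by blast
  define \<Lambda> :: "(real ^ ('d + 'd)) set" where "\<Lambda> = (*v) (\<epsilon> *\<^sub>R mat 1) ` {k. \<forall>i. k $ i \<in> \<int>}"
  let ?Q = "\<lambda>T. restrict (cohen_diag (gaussian_window :: (real ^ 'd) L2 \<Rightarrow> (real ^ 'd) L2) T) \<Lambda>"
  have "invertible (\<epsilon> *\<^sub>R mat 1 :: real ^ ('d + 'd) ^ ('d + 'd))"
    using \<epsilon> by (intro scalar_invertible) (auto simp: invertible_def)
  then have "is_lattice \<Lambda>"
    unfolding is_lattice_def \<Lambda>_def by blast
  moreover have "identifiable \<Lambda> gaussian_window (symbol_supported \<mu>\<A> K)"
    unfolding identifiable_def
  proof
    show "?Q \<in> symbol_supported \<mu>\<A> K \<rightarrow> ell_infty \<Lambda>"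
      by (auto simp: symbol_supported_def ell_infty_def
          intro!: bounded_subset[OF bounded_range_cohen_diag])
    show "inj_on ?Q (symbol_supported \<mu>\<A> K)"
    proof
      fix T T' assume "T \<in> symbol_supported \<mu>\<A> K" "T' \<in> symbol_supported \<mu>\<A> K" and eq: "?Q T = ?Q T'"
      then obtain \<sigma> \<sigma>' where T: "T \<in> hilbert_schmidt" "has_weyl_symbol T \<sigma>" "L2_support (\<mu>\<A> \<sigma>) \<subseteq> K"
        and T': "T' \<in> hilbert_schmidt" "has_weyl_symbol T' \<sigma>'" "L2_support (\<mu>\<A> \<sigma>') \<subseteq> K"
        by (auto simp: symbol_supported_def)
      \<comment> \<open>Injectivity is reduced to the difference of the symbols, whose image under
        \<open>\<mu>\<A>\<close> again vanishes almost everywhere outside \<open>K\<close>.\<close>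
      have "\<sigma> - \<sigma>' = 0"
      proof (rule sampling[rule_format])
        have "linear \<mu>\<A>"
          using \<open>is_metaplectic \<A> \<mu>\<A>\<close>
          by (simp add: is_metaplectic_def unitary_op_def cbounded_linear_def bounded_linear.linear)
        then have diff: "\<mu>\<A> (\<sigma> - \<sigma>') = \<mu>\<A> \<sigma> - \<mu>\<A> \<sigma>'"
          by (rule linear_diff)
        show "AE t in lborel. norm t > R \<longrightarrow> rep_L2 (\<mu>\<A> (\<sigma> - \<sigma>')) t = 0"
          unfolding diff
          using rep_L2_diff[of "\<mu>\<A> \<sigma>" "\<mu>\<A> \<sigma>'"] AE_L2_support[of "\<mu>\<A> \<sigma>"] AE_L2_support[of "\<mu>\<A> \<sigma>'"]
        proof eventually_elim
          case (elim t)
          have "t \<notin> K" if "norm t > R" using that R by auto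
          with elim T(3) T'(3) show ?case by auto
        qed
      next
        fix k :: "real ^ ('d + 'd)" assume k: "\<And>i. k $ i \<in> \<int>"
        let ?z = "\<epsilon> *\<^sub>R k"
        have "?z = (\<epsilon> *\<^sub>R mat 1) *v k"
          by (simp add: scaleR_matrix_vector_assoc[symmetric])
        then have "?z \<in> \<Lambda>"
          using k unfolding \<Lambda>_def by blast
        then have "cohen_diag gaussian_window T ?z = cohen_diag gaussian_window T' ?z"
          using fun_cong[OF eq, of ?z] by simp
        \<comment> \<open>A sample is a Hilbert-Schmidt pairing with a rank-one operator, so the
          duality in \<open>has_weyl_symbol\<close> rewrites it as a pairing of the symbol with a
          coherent state.\<close>
        then have "cinner \<sigma> (c *\<^sub>C \<rho> (phase_point ?z 0) symbol_gaussian) =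
            cinner \<sigma>' (c *\<^sub>C \<rho> (phase_point ?z 0) symbol_gaussian)"
          using T(2) T'(2)
          by (simp add: cohen_diag_def gaussian_window_def op_shift_rank_one has_weyl_symbol_def wigner)
        then show "cinner (\<sigma> - \<sigma>') (\<rho> (phase_point ?z 0) symbol_gaussian) = 0"
          using c by (simp add: cinner_scaleC_right cinner_diff_left)
      qed
      \<comment> \<open>Read in the other direction, the same duality turns equal symbols into equal
        matrix coefficients.\<close>
      then have "cinner (T g) f = cinner (T' g) f" for f g
        using T T' by (simp add: has_weyl_symbol_def flip: hs_inner_rank_one)
      then have "cinner (T g - T' g) (T g - T' g) = 0" for g
        by (simp add: cinner_diff_left)
      then show "T = T'"
        using cinner_eq_0_imp_eq_0 by fastforce
    qed
  qed
  ultimately show ?thesis by blast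
qed

end
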